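(* Let $d\geq3$. There exists a constant $C>0$ depending on $d$ such that, for every $\tau>0$ and $\lambda=\tau^2$, $$\|f\|_{Z_{\lambda,p_d}^*}\leq C\|f\|_{\dot Y_\tau^{1/2}}$$ for all $f\in\mathcal{S}(\mathbb{R}^d)$.
   Context: $\widehat f(\xi) = (2\pi)^{-d/2}\int_{\mathbb{R}^d} e^{-ix\cdot\xi} f(x)\,\mathrm{d}x$. For $s\in\mathbb{R}$, $\|f\|_{\dot Y^s_\tau}=\||q_\tau|^s\widehat f\|_{L^2}$ with $q_\tau(\xi)=-|\xi|^2+2i\tau\xi_d+\tau^2$. $1/p_d=1/2-1/d$. Littlewood–Paley projectors: $\phi\in\mathcal{S}(\mathbb{R}^d)$ supported in $\{|\xi|\leq2\}$ with $\phi=1$ on $\{|\xi|\leq1\}$, $\psi(\xi)=\phi(\xi)-\phi(2\xi)$, $\widehat{P_kf}(\xi)=\psi(\xi/2^k)\widehat f(\xi)$, $\widehat{P_{\leq k}f}(\xi)=\phi(\xi/2^k)\widehat f(\xi)$. Given $\lambda>0$, $m_\lambda(\xi) = |\lambda - |\xi|^2|$, $k_\lambda\in\mathbb{Z}$ satisfies $2^{k_\lambda-1}<\lambda^{1/2}\leq2^{k_\lambda}$, $I=\{k_\lambda-2,k_\lambda-1,k_\lambda,k_\lambda+1\}$, $P_{<I}=P_{\leq k_\lambda-3}$, and $$\|u\|_{Z_{\lambda,p_d}^*}^2 = \|m_\lambda^{1/2}\widehat{P_{<I} u}\|_{L^2}^2 + \sum_{k\in I}\|P_k u\|_{L^{p_d}}^2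 +\sum_{k > k_\lambda + 1}\|m_\lambda^{1/2}\widehat{P_k u}\|_{L^2}^2.$$ *)

theory Defs
  imports "HOL-Analysis.Analysis"
begin

section \<open>Schwartz functions\<close>

definition partial_deriv :: "'n::finite \<Rightarrow> (real^'n \<Rightarrow> complex) \<Rightarrow> real^'n \<Rightarrow> complex" where
  "partial_deriv i f x = frechet_derivative f (at x) (axis i 1)"

fun iter_partial :: "'n::finite list \<Rightarrow> (real^'n \<Rightarrow> complex) \<Rightarrow> real^'n \<Rightarrow> complex" where
  "iter_partial [] f = f"
| "iter_partial (i # is) f = partial_deriv i (iter_partial is f)"

text \<open>Differentiability of all iterated partial derivatives is smoothness. Multi-indices are
  rendered by lists of coordinates, and the weights \<open>(1 + |x|)\<^sup>N\<close> replace the monomials in the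
  usual (equivalent) family of seminorms.\<close>

definition schwartz :: "(real^'n::finite \<Rightarrow> complex) \<Rightarrow> bool" where
  "schwartz f \<longleftrightarrow>
     (\<forall>is x. iter_partial is f differentiable (at x)) \<and>
     (\<forall>is (N::nat). \<exists>B. \<forall>x. (1 + norm x) ^ N * norm (iter_partial is f x) \<le> B)"

section \<open>Fourier transform\<close>

definition fourier :: "(real^'n::finite \<Rightarrow> complex) \<Rightarrow> real^'n \<Rightarrow> complex" where
  "fourier f \<xi> = of_real ((2 * pi) powr (- real CARD('n) / 2)) *
     (LINT x|lborel. exp (- \<i> * of_real (x \<bullet> \<xi>)) * f x)"

definition inv_fourier :: "(real^'n::finite \<Rightarrow> complex) \<Rightarrow> real^'n \<Rightarrow> complex" where
  "inv_fourier g x = of_real ((2 * pi) powr (- real CARD('n) / 2)) *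
     (LINT \<xi>|lborel. exp (\<i> * of_real (x \<bullet> \<xi>)) * g \<xi>)"

section \<open>Extended-valued Lebesgue norms\<close>

text \<open>All norms take values in \<open>[0, \<infinity>]\<close>, so that an infinite norm is not confused with 0.
  The power is only used with exponents \<open>a > 0\<close>.\<close>

definition epowr :: "ennreal \<Rightarrow> real \<Rightarrow> ennreal" where
  "epowr x a = (if x = \<infinity> then \<infinity> else ennreal (enn2real x powr a))"

definition Lp_norm :: "real \<Rightarrow> (real^'n::finite \<Rightarrow> complex) \<Rightarrow> ennreal" where
  "Lp_norm p f = epowr (\<integral>\<^sup>+x. ennreal (norm (f x) powr p) \<partial>lborel) (1 / p)"

section \<open>The spaces \<open>\<dot>Y\<close>\<close>

text \<open>The index \<open>e\<close> designates the coordinate written \<open>\<xi>\<^sub>d\<close> (the elements of the index type carry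
  no order, so it is a parameter).\<close>

definition q_symbol :: "'n::finite \<Rightarrow> real \<Rightarrow> real^'n \<Rightarrow> complex" where
  "q_symbol e \<tau> \<xi> = - of_real ((norm \<xi>)\<^sup>2) + 2 * \<i> * of_real \<tau> * of_real (\<xi> $ e) + of_real (\<tau>\<^sup>2)"

definition Y_norm :: "'n::finite \<Rightarrow> real \<Rightarrow> real \<Rightarrow> (real^'n \<Rightarrow> complex) \<Rightarrow> ennreal" where
  "Y_norm e s \<tau> f = Lp_norm 2 (\<lambda>\<xi>. of_real (norm (q_symbol e \<tau> \<xi>) powr s) * fourier f \<xi>)"

section \<open>Littlewood--Paley projectors\<close>

definition LP_cutoff :: "(real^'n::finite \<Rightarrow> complex) \<Rightarrow> bool" where
  "LP_cutoff \<phi> \<longleftrightarrow> schwartz \<phi> \<and> (\<forall>\<xi>. norm \<xi> > 2 \<longrightarrow> \<phi> \<xi> = 0) \<and> (\<forall>\<xi>. norm \<xi> \<le> 1 \<longrightarrow> \<phi> \<xi> = 1)"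

definition LP_psi :: "(real^'n::finite \<Rightarrow> complex) \<Rightarrow> real^'n \<Rightarrow> complex" where
  "LP_psi \<phi> \<xi> = \<phi> \<xi> - \<phi> (2 *\<^sub>R \<xi>)"

definition LP_proj :: "(real^'n::finite \<Rightarrow> complex) \<Rightarrow> int \<Rightarrow> (real^'n \<Rightarrow> complex) \<Rightarrow> real^'n \<Rightarrow> complex" where
  "LP_proj \<phi> k f = inv_fourier (\<lambda>\<xi>. LP_psi \<phi> (\<xi> /\<^sub>R (2 powi k)) * fourier f \<xi>)"

definition LP_proj_le :: "(real^'n::finite \<Rightarrow> complex) \<Rightarrow> int \<Rightarrow> (real^'n \<Rightarrow> complex) \<Rightarrow> real^'n \<Rightarrow> complex" where
  "LP_proj_le \<phi> k f = inv_fourier (\<lambda>\<xi>. \<phi> (\<xi> /\<^sub>R (2 powi k)) * fourier f \<xi>)"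

section \<open>The norm of \<open>Z\<^sup>*\<close>\<close>

definition p_exponent :: "nat \<Rightarrow> real" where
  "p_exponent d = 1 / (1 / 2 - 1 / real d)"

definition m_symbol :: "real \<Rightarrow> real^'n::finite \<Rightarrow> real" where
  "m_symbol lam \<xi> = \<bar>lam - (norm \<xi>)\<^sup>2\<bar>"

definition k_index :: "real \<Rightarrow> int" where
  "k_index lam = (THE k. 2 powi (k - 1) < sqrt lam \<and> sqrt lam \<le> 2 powi k)"

lemma k_index_eqI:
  assumes "2 powi (k - 1) < sqrt lam" "sqrt lam \<le> 2 powi k"
  shows "k_index lam = k"
  unfolding k_index_def
proof (rule the_equality)
  fix j :: int
  assume j: "2 powi (j - 1) < sqrt lam \<and> sqrt lam \<le> 2 powi j"
  have "(2::real) powi (j - 1) < 2 powi k" "(2::real) powi (k - 1) < 2 powi j"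
    using j assms by linarith+
  then have "j - 1 < k" "k - 1 < j"
    using power_int_increasing[of k "j - 1" "2::real"] power_int_increasing[of j "k - 1" "2::real"]
    by (force simp: not_le[symmetric])+
  then show "j = k" by simp
qed (use assms in simp)

lemma k_index_bounds:
  assumes "lam > 0"
  shows "2 powi (k_index lam - 1) < sqrt lam" "sqrt lam \<le> 2 powi k_index lam"
proof -
  define k where "k = \<lceil>log 2 (sqrt lam)\<rceil>"
  have *: "(2::real) powi j = 2 powr of_int j" for j
    by (simp add: powr_real_of_int')
  have "of_int (k - 1) < log 2 (sqrt lam)" "log 2 (sqrt lam) \<le> of_int k"
    unfolding k_def by linarith+
  then have b: "2 powi (k - 1) < sqrt lam" "sqrt lam \<le> 2 powi k"
    using assms unfolding * by (auto simp: less_log_iff log_le_iff)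
  with k_index_eqI[OF b]
  show "2 powi (k_index lam - 1) < sqrt lam" "sqrt lam \<le> 2 powi k_index lam" by simp_all
qed

definition Zstar_norm ::
    "(real^'n::finite \<Rightarrow> complex) \<Rightarrow> real \<Rightarrow> real \<Rightarrow> (real^'n \<Rightarrow> complex) \<Rightarrow> ennreal" where
  "Zstar_norm \<phi> lam p u = epowr (
     (Lp_norm 2 (\<lambda>\<xi>. of_real (sqrt (m_symbol lam \<xi>)) * fourier (LP_proj_le \<phi> (k_index lam - 3) u) \<xi>))\<^sup>2
     + (\<Sum>k\<in>{k_index lam - 2 .. k_index lam + 1}. (Lp_norm p (LP_proj \<phi> k u))\<^sup>2)
     + (\<Sum>\<^sub>\<infinity>k\<in>{k. k > k_index lam + 1}.
          (Lp_norm 2 (\<lambda>\<xi>. of_real (sqrt (m_symbol lam \<xi>)) * fourier (LP_proj \<phi> k u) \<xi>))\<^sup>2))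
     (1 / 2)"

end

theory Submission
  imports Defs "HOL-Probability.Probability"
begin

text \<open>The frequencies far from the sphere \<open>|\<xi>| = \<tau>\<close> cost nothing: \<open>m\<^sub>\<lambda> = |Re q\<^sub>\<tau>| \<le> |q\<^sub>\<tau>|\<close> pointwise, and the
cutoffs of the dyadic pieces overlap boundedly. Since the norms are computed from the Fourier transform
of an inverse Fourier transform, the analytic input there is Fourier inversion (\<open>fourier_inversion\<close>).

The substance is the bound \<open>\<parallel>\<F> g\<parallel>\<^sub>p \<le> C \<parallel>|q\<^sub>\<tau>|\<^bsup>1/2\<^esup> g\<parallel>\<^sub>2\<close>, with \<open>p = 2d/(d - 2)\<close>, for \<open>g\<close> supported
in \<open>|\<xi>| \<le> 8\<tau>\<close> (\<open>extension_estimate\<close>). By scaling, \<open>\<tau> = 1\<close>. The symbol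
\<open>|q|\<^sup>2 = (|\<xi>|\<^sup>2 - 1)\<^sup>2 + 4\<xi>\<^sub>d\<^sup>2\<close> vanishes on a sphere of codimension two, and \<open>p\<close> is the Stein--Tomas
exponent of that sphere inside the hyperplane \<open>\<xi>\<^sub>d = 0\<close>. The second codimension leaves a power of the
distance to the sphere to spare. This pays for losing half a power of the decay in time (averages of
Gaussians are estimated in absolute value, without the cancellation between different times), and it
makes the estimate hold in weak form on both sides of \<open>p\<close>, from which the strong form follows.

Dispersion comes from Gaussians alone. One has \<open>1/|q| = c \<integral> exp (-r\<^sup>2|q|\<^sup>2) dr\<close>, and
\<open>exp (-r\<^sup>2(|\<xi>|\<^sup>2 - 1)\<^sup>2)\<close> is the average of \<open>exp (i\<surd>2 r s (|\<xi>|\<^sup>2 - 1))\<close> over a standard normal variable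
\<open>s\<close>. After multiplication by \<open>exp (-|\<xi>|\<^sup>2)\<close>, which is harmless on a ball, the weight \<open>1/|q|\<close> is a superposition of
complex Gaussians \<open>exp (-\<Sum> z\<^sub>i \<xi>\<^sub>i\<^sup>2)\<close>. The Fourier transform of such a Gaussian is bounded by
\<open>\<Prod> (\<pi>/|z\<^sub>i|)\<^bsup>1/2\<^esup>\<close> (\<open>gaussian_fourier_bound\<close>), with \<open>|z\<^sub>i| \<ge> r|s|\<close> in all directions and
\<open>|z\<^sub>d| \<ge> r\<^sup>2\<close> in the last one.

Let \<open>|G| \<le> 1\<^sub>E\<close> with \<open>|E| = V\<close>. The Gaussian energy of \<open>\<F> G\<close> is at most \<open>V\<close> by Plancherel and
at most \<open>b V\<^sup>2\<close>, where \<open>b = \<Prod> |z\<^sub>i|\<^bsup>-1/2\<^esup>\<close>, by dispersion, hence at most \<open>b\<^bsup>\<theta>\<^esup> V\<^bsup>1+\<theta>\<^esup>\<close> for every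
\<open>\<theta> \<in> [0, 1]\<close>. Averaging over \<open>s\<close> requires \<open>\<theta>(d - 1)/2 < 1\<close>, and integrating over \<open>r\<close> requires
\<open>\<theta>(d + 1)/2 > 1\<close>; then \<open>\<integral> exp (-|\<xi>|\<^sup>2) |\<F> G|\<^sup>2/|q| \<le> C V\<^bsup>1+\<theta>\<^esup>\<close> (\<open>energy_with_singular_weight\<close>).
Testing \<open>\<F> g\<close> against the phase of \<open>\<F> g\<close> on a level set \<open>{|\<F> g| \<ge> \<alpha>}\<close> and using Cauchy--Schwarz turns this
into a weak-type bound with exponent \<open>2/(1 - \<theta>)\<close> (\<open>level_set_measure\<close>). The value \<open>\<theta> = 2/d\<close> that
corresponds to \<open>p\<close> lies strictly inside the admissible interval \<open>(2/(d + 1), 2/(d - 1))\<close>, so the weak-type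
bounds hold on both sides of \<open>p\<close>, and the layer-cake formula (\<open>layer_cake_interpolation\<close>) gives the
strong bound.\<close>

section \<open>Fourier transforms of complex Gaussians\<close>

lemma (in pair_sigma_finite) integrable_dominated_by_product:
  fixes F :: "'a \<times> 'b \<Rightarrow> 'c::{banach, second_countable_topology}" and f :: "'a \<Rightarrow> real" and g :: "'b \<Rightarrow> real"
  assumes f: "integrable M1 f" and g: "integrable M2 g"
    and F: "F \<in> borel_measurable (M1 \<Otimes>\<^sub>M M2)" and le: "\<And>x y. norm (F (x, y)) \<le> f x * g y"
  shows "integrable (M1 \<Otimes>\<^sub>M M2) F"
proof -
  have [measurable]: "f \<in> borel_measurable M1" "g \<in> borel_measurable M2" using f g by auto
  have "integrable (M1 \<Otimes>\<^sub>M M2) (\<lambda>(x, y). f x * g y)"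
    by (rule Fubini_integrable) (use f g in \<open>auto simp: abs_mult\<close>)
  then show ?thesis
    by (rule Bochner_Integration.integrable_bound) (use F le in \<open>auto intro!: order_trans[OF le]\<close>)
qed

lemma borel_measurable_cnj [measurable]:
  "f \<in> borel_measurable M \<Longrightarrow> (\<lambda>x. cnj (f x)) \<in> borel_measurable M"
  by (rule borel_measurable_continuous_on[of cnj]) (auto intro: continuous_intros)

lemma gaussian_integrable:
  fixes z :: complex
  assumes "Re z > 0"
  shows "integrable lborel (\<lambda>\<xi>::real. exp (- \<i> * of_real (x * \<xi>) - z * of_real (\<xi>\<^sup>2)))"
proof -
  define \<sigma> where "\<sigma> = 1 / sqrt (2 * Re z)"
  have s: "\<sigma> > 0" "2 * \<sigma>\<^sup>2 = 1 / Re z"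
    using assms by (auto simp: \<sigma>_def power_divide)
  have "integrable lborel (\<lambda>\<xi>. sqrt (2 * pi * \<sigma>\<^sup>2) * normal_density 0 \<sigma> \<xi>)"
    using s by (intro integrable_mult_right integrable_normal_density) auto
  also have "(\<lambda>\<xi>. sqrt (2 * pi * \<sigma>\<^sup>2) * normal_density 0 \<sigma> \<xi>) = (\<lambda>\<xi>. exp (- Re z * \<xi>\<^sup>2))"
    using s by (auto simp: normal_density_def fun_eq_iff field_simps)
  finally have i: "integrable lborel (\<lambda>\<xi>. exp (- Re z * \<xi>\<^sup>2))" .
  show ?thesis
    by (rule Bochner_Integration.integrable_bound[OF i]) (auto)
qed

text \<open>With \<open>\<xi> = s / (2a)\<^bsup>1/2\<^esup>\<close> this is the characteristic function of the standard normal distribution.\<close>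

lemma gaussian_fourier_real:
  fixes a x :: real
  assumes a: "a > 0"
  shows "(LINT \<xi>|lborel. exp (- \<i> * of_real (x * \<xi>) - of_real a * of_real (\<xi>\<^sup>2)))
    = complex_of_real (sqrt (pi / a) * exp (- x\<^sup>2 / (4 * a)))"
proof -
  define c where "c = 1 / sqrt (2 * a)"
  have c: "c > 0" "a * c\<^sup>2 = 1 / 2" using a by (auto simp: c_def power_divide)
  let ?f = "\<lambda>\<xi>::real. exp (- \<i> * of_real (x * \<xi>) - of_real a * of_real (\<xi>\<^sup>2))"
  have "(LINT \<xi>|lborel. ?f \<xi>) = c *\<^sub>R (LINT s|lborel. ?f (c * s))"
    using lborel_integral_real_affine[of c ?f 0] c by simp
  also have "(\<lambda>s. ?f (c * s)) = (\<lambda>s. of_real (sqrt (2 * pi)) * (std_normal_density s *\<^sub>R iexp ((- x * c) * s)))"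
  proof
    fix s
    have "?f (c * s) = exp (\<i> * of_real ((- x * c) * s) + of_real (- s\<^sup>2 / 2))"
    proof -
      have "a * (c * s)\<^sup>2 = s\<^sup>2 / 2" using c(2) by (simp add: power_mult_distrib)
      then have h: "complex_of_real a * of_real ((c * s)\<^sup>2) = of_real (s\<^sup>2 / 2)"
        by (metis of_real_mult)
      have "- \<i> * of_real (x * (c * s)) - of_real a * of_real ((c * s)\<^sup>2)
         = \<i> * of_real ((- x * c) * s) + complex_of_real (- s\<^sup>2 / 2)"
        unfolding h by (simp add: mult.assoc)
      then show ?thesis by (rule arg_cong[where f = exp])
    qed
    also have "\<dots> = of_real (exp (- s\<^sup>2 / 2)) * iexp ((- x * c) * s)"
      by (simp only: exp_add exp_of_real mult.commute)
    finally show "?f (c * s) = of_real (sqrt (2 * pi)) * (std_normal_density s *\<^sub>R iexp ((- x * c) * s))"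
      by (simp add: std_normal_density_def scaleR_conv_of_real)
  qed
  also have "(LINT s|lborel. of_real (sqrt (2 * pi)) * (std_normal_density s *\<^sub>R iexp ((- x * c) * s)))
      = of_real (sqrt (2 * pi)) * char std_normal_distribution (- x * c)"
    unfolding char_def integral_mult_right_zero by (subst integral_density) auto
  also have "\<dots> = of_real (sqrt (2 * pi) * exp (- (x * c)\<^sup>2 / 2))"
    by (simp add: char_std_normal_distribution)
  also have "- (x * c)\<^sup>2 / 2 = - x\<^sup>2 / (4 * a)"
    using a by (simp add: c_def power_mult_distrib power_divide)
  also have "c *\<^sub>R complex_of_real (sqrt (2 * pi) * exp (- x\<^sup>2 / (4 * a))) =
      complex_of_real (sqrt (pi / a) * exp (- x\<^sup>2 / (4 * a)))"
    using a by (simp add: c_def scaleR_conv_of_real real_sqrt_mult real_sqrt_divide field_simps)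
  finally show ?thesis by simp
qed

text \<open>The dispersive estimate in one variable: the bound depends on \<open>|z|\<close> and not only on \<open>Re z\<close>. For the
squared modulus of the integral, the variables \<open>v\<close> (midpoint) and \<open>u\<close> (difference) make the exponent
real up to terms that are linear in each variable, so that both integrations are Fourier transforms of
real Gaussians and no square root of a complex number has to be chosen.\<close>

lemma gaussian_fourier_bound:
  fixes z :: complex
  assumes z: "Re z > 0"
  shows "norm (LINT \<xi>|lborel. exp (- \<i> * of_real (x * \<xi>) - z * of_real (\<xi>\<^sup>2))) \<le> sqrt (pi / norm z)"
proof -
  define \<rho> \<sigma> where "\<rho> = Re z" "\<sigma> = Im z"
  have rho: "\<rho> > 0" using z by (simp add: \<rho>_\<sigma>_def)
  have z': "z = Complex \<rho> \<sigma>" by (simp add: \<rho>_\<sigma>_def)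
  define F where "F = (\<lambda>\<xi>::real. exp (- \<i> * of_real (x * \<xi>) - z * of_real (\<xi>\<^sup>2)))"
  have Fi: "integrable lborel F" unfolding F_def by (rule gaussian_integrable[OF z])
  have Fm[measurable]: "F \<in> borel_measurable borel" unfolding F_def by measurable
  \<comment> \<open>The imaginary part of \<open>z\<close> multiplies \<open>(v + u/2)\<^sup>2 - (v - u/2)\<^sup>2 = 2uv\<close> and becomes a frequency.\<close>
  have "F (v + u / 2) * cnj (F (v - u / 2)) = exp (- \<i> * of_real (x * u) - of_real (\<rho> / 2) * of_real (u\<^sup>2))
       * exp (- \<i> * of_real ((2 * \<sigma> * u) * v) - of_real (2 * \<rho>) * of_real (v\<^sup>2))" for u v
    unfolding F_def exp_cnj exp_add[symmetric] z'
    by (rule arg_cong[where f = exp]) (simp add: complex_eq_iff field_simps power2_eq_square)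
  note FF = this
  define I where "I = (LINT \<xi>|lborel. F \<xi>)"
  have Ish: "integrable lborel (\<lambda>u. F (\<eta> + u))" "(LINT u|lborel. F (\<eta> + u)) = I"
    "(LINT u|lborel. norm (F (\<eta> + u))) = (LINT u|lborel. norm (F u))" for \<eta>
    using lborel_integrable_real_affine[OF Fi, of 1 \<eta>] lborel_integral_real_affine[of 1 F \<eta>]
      lborel_integral_real_affine[of 1 "\<lambda>u. norm (F u)" \<eta>]
    by (simp_all add: I_def)
  have [measurable]: "(\<lambda>(\<eta>, u). F (\<eta> + u) * cnj (F \<eta>)) \<in> borel_measurable (lborel \<Otimes>\<^sub>M lborel)"
    unfolding split_beta' by measurable
  have pair: "integrable (lborel \<Otimes>\<^sub>M lborel) (\<lambda>(\<eta>, u). F (\<eta> + u) * cnj (F \<eta>))"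
    using Fi by (intro lborel_pair.Fubini_integrable) (auto simp: norm_mult Ish)
  have "I * cnj I = (LINT \<eta>|lborel. I * cnj (F \<eta>))"
    by (simp add: I_def)
  also have "\<dots> = (LINT \<eta>|lborel. (LINT u|lborel. F (\<eta> + u) * cnj (F \<eta>)))"
    using Ish by (intro Bochner_Integration.integral_cong refl) simp
  also have "\<dots> = (LINT u|lborel. (LINT \<eta>|lborel. F (\<eta> + u) * cnj (F \<eta>)))"
    using lborel_pair.Fubini_integral[OF pair] by simp
  also have "\<dots> = (LINT u|lborel. (LINT v|lborel. F (v + u / 2) * cnj (F (v - u / 2))))"
  proof (rule Bochner_Integration.integral_cong[OF refl])
    fix u :: real
    show "(LINT \<eta>|lborel. F (\<eta> + u) * cnj (F \<eta>)) = (LINT v|lborel. F (v + u / 2) * cnj (F (v - u / 2)))"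
      by (subst lborel_integral_real_affine[of 1 _ "- u / 2"]) (simp_all add: algebra_simps)
  qed
  also have "\<dots> = (LINT u|lborel. exp (- \<i> * of_real (x * u) - of_real (\<rho> / 2) * of_real (u\<^sup>2)) *
       of_real (sqrt (pi / (2 * \<rho>)) * exp (- (2 * \<sigma> * u)\<^sup>2 / (4 * (2 * \<rho>)))))"
    unfolding FF integral_mult_right_zero using rho by (subst gaussian_fourier_real) simp_all
  finally have I: "I * cnj I = (LINT u|lborel. exp (- \<i> * of_real (x * u) - of_real (\<rho> / 2) * of_real (u\<^sup>2)) *
       of_real (sqrt (pi / (2 * \<rho>)) * exp (- (2 * \<sigma> * u)\<^sup>2 / (4 * (2 * \<rho>)))))" (is "_ = integral\<^sup>L _ ?g") .
  define a where "a = (\<rho>\<^sup>2 + \<sigma>\<^sup>2) / (2 * \<rho>)"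
  have a: "a > 0" using rho by (simp add: a_def add_pos_nonneg)
  have "norm (?g u) = sqrt (pi / (2 * \<rho>)) * exp (- a * u\<^sup>2)" for u
  proof -
    have "norm (?g u) = sqrt (pi / (2 * \<rho>)) * (exp (- (\<rho> / 2) * u\<^sup>2) * exp (- (2 * \<sigma> * u)\<^sup>2 / (4 * (2 * \<rho>))))"
      using rho by (simp add: norm_mult)
    also have "exp (- (\<rho> / 2) * u\<^sup>2) * exp (- (2 * \<sigma> * u)\<^sup>2 / (4 * (2 * \<rho>))) = exp (- a * u\<^sup>2)"
      unfolding exp_add[symmetric] a_def using rho
      by (intro arg_cong[where f = exp]) (simp add: field_simps power2_eq_square)
    finally show ?thesis .
  qed
  note ng = this
  have "complex_of_real (LINT u|lborel. exp (- a * u\<^sup>2)) = of_real (sqrt (pi / a))"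
    using gaussian_fourier_real[OF a, of 0] unfolding integral_complex_of_real[symmetric]
    by (simp flip: exp_of_real)
  then have ga: "(LINT u|lborel. exp (- a * u\<^sup>2)) = sqrt (pi / a)" by (simp only: of_real_eq_iff)
  have "norm I ^ 2 = norm (I * cnj I)"
    by (simp add: norm_mult power2_eq_square)
  also have "\<dots> \<le> (LINT u|lborel. norm (?g u))"
    unfolding I by (rule integral_norm_bound)
  also have "\<dots> = sqrt (pi / (2 * \<rho>)) * (LINT u|lborel. exp (- a * u\<^sup>2))"
    unfolding ng by simp
  also have "(LINT u|lborel. exp (- a * u\<^sup>2)) = sqrt (pi / a)" by (rule ga)
  also have "sqrt (pi / (2 * \<rho>)) * sqrt (pi / a) = pi / norm z"
  proof -
    have "pi / (2 * \<rho>) * (pi / a) = (pi / norm z)\<^sup>2"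
      using rho by (simp add: a_def cmod_power2 power_divide flip: \<rho>_\<sigma>_def) (simp add: power2_eq_square)
    then show ?thesis by (simp flip: real_sqrt_mult)
  qed
  finally show ?thesis by (simp add: I_def F_def real_le_rsqrt)
qed

lemma
  fixes g :: "'n::finite \<Rightarrow> real \<Rightarrow> complex"
  assumes g: "\<And>i. integrable lborel (g i)"
  shows integrable_prod_coordinates: "integrable lborel (\<lambda>\<xi>::real^'n. \<Prod>i\<in>UNIV. g i (\<xi> $ i))"
    and integral_prod_coordinates: "(LINT \<xi>|(lborel :: (real^'n) measure). (\<Prod>i\<in>UNIV. g i (\<xi> $ i))) = (\<Prod>i\<in>UNIV. (LINT t|lborel. g i t))"
proof -
  interpret product_sigma_finite "\<lambda>_::real^'n. lborel :: real measure" ..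
  have B: "(Basis :: (real^'n) set) = range (\<lambda>i. axis i 1)" by (auto simp: Basis_vec_def)
  have inj: "inj (\<lambda>i::'n. axis i (1::real))" by (auto simp: inj_def axis_eq_axis)
  define h where "h b = g (axis_index b)" for b :: "real^'n"
  have h: "h (axis i 1) = g i" for i by (simp add: h_def)
  have hm[measurable]: "h b \<in> borel_measurable borel" for b unfolding h_def using g by auto
  have gm[measurable]: "g b \<in> borel_measurable borel" for b using g[of b] by auto
  have comp: "(\<Prod>i\<in>UNIV. g i ((\<Sum>b\<in>Basis. f b *\<^sub>R b :: real^'n) $ i)) = (\<Prod>b\<in>Basis. h b (f b))" for f
  proof -
    have "(\<Sum>b\<in>Basis. f b *\<^sub>R b :: real^'n) $ i = f (axis i 1)" for i
    proof -
      have "(\<Sum>b\<in>Basis. f b *\<^sub>R b :: real^'n) $ i = (\<Sum>b\<in>Basis. f b *\<^sub>R b :: real^'n) \<bullet> axis i 1"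
        by (simp add: inner_axis)
      also have "\<dots> = f (axis i 1)" by (simp add: inner_sum_left_Basis)
      finally show ?thesis .
    qed
    then show ?thesis unfolding B prod.reindex[OF inj] by (simp add: h)
  qed
  let ?P = "\<Pi>\<^sub>M b\<in>(Basis :: (real^'n) set). (lborel :: real measure)"
  have i: "integrable ?P (\<lambda>f. \<Prod>b\<in>Basis. h b (f b))"
    by (rule product_integrable_prod) (auto simp: h_def g)
  have m[measurable]: "(\<lambda>f. \<Sum>b\<in>Basis. f b *\<^sub>R b :: real^'n) \<in> measurable ?P borel"
    by measurable
  show "integrable lborel (\<lambda>\<xi>::real^'n. \<Prod>i\<in>UNIV. g i (\<xi> $ i))"
    unfolding lborel_eq[where 'a="real^'n"]
    by (subst integrable_distr_eq[OF m]) (measurable, unfold comp, rule i)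
  have "(LINT \<xi>|(lborel :: (real^'n) measure). (\<Prod>i\<in>UNIV. g i (\<xi> $ i))) = (\<integral>f. (\<Prod>b\<in>Basis. h b (f b)) \<partial>?P)"
    unfolding lborel_eq[where 'a="real^'n"]
    by (subst integral_distr[OF m]) (measurable, unfold comp, rule refl)
  also have "\<dots> = (\<Prod>b\<in>Basis. integral\<^sup>L lborel (h b))"
    by (rule product_integral_prod) (auto simp: h_def g)
  also have "\<dots> = (\<Prod>i\<in>UNIV. (LINT t|lborel. g i t))"
    unfolding B prod.reindex[OF inj] by (simp add: h)
  finally show "(LINT \<xi>|(lborel :: (real^'n) measure). (\<Prod>i\<in>UNIV. g i (\<xi> $ i))) = (\<Prod>i\<in>UNIV. (LINT t|lborel. g i t))" .
qed

text \<open>One complex parameter per coordinate: real parts damp, imaginary parts disperse, and the distinguished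
coordinate may be damped more strongly than the others.\<close>

definition gauss_weight :: "('n::finite \<Rightarrow> complex) \<Rightarrow> real^'n \<Rightarrow> complex" where
  "gauss_weight z \<xi> = exp (- (\<Sum>i\<in>UNIV. z i * of_real ((\<xi> $ i)\<^sup>2)))"

definition gauss_kernel :: "('n::finite \<Rightarrow> complex) \<Rightarrow> real^'n \<Rightarrow> complex" where
  "gauss_kernel z x = (LINT \<xi>|lborel. exp (- \<i> * of_real (x \<bullet> \<xi>)) * gauss_weight z \<xi>)"

lemma gauss_weight_measurable [measurable]: "gauss_weight z \<in> borel_measurable borel"
  unfolding gauss_weight_def by measurable

lemma gauss_weight_product:
  "exp (- \<i> * of_real (x \<bullet> \<xi>)) * gauss_weight z \<xi>
    = (\<Prod>i\<in>UNIV. exp (- \<i> * of_real (x $ i * \<xi> $ i) - z i * of_real ((\<xi> $ i)\<^sup>2)))"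
  unfolding gauss_weight_def exp_sum[OF finite, symmetric] exp_add[symmetric] inner_vec_def
  by (rule arg_cong[where f=exp]) (simp add: sum_subtractf sum_distrib_left sum_negf)

lemma
  assumes z: "\<And>i. Re (z i) > 0"
  shows gauss_weight_exp_integrable: "integrable lborel (\<lambda>\<xi>. exp (- \<i> * of_real (x \<bullet> \<xi>)) * gauss_weight z \<xi>)"
    and gauss_kernel_bound: "norm (gauss_kernel z x) \<le> (\<Prod>i\<in>UNIV. sqrt (pi / norm (z i)))"
proof -
  have i: "integrable lborel (\<lambda>t. exp (- \<i> * of_real (x $ i * t) - z i * of_real (t\<^sup>2)))" for i
    by (rule gaussian_integrable[OF z])
  show "integrable lborel (\<lambda>\<xi>. exp (- \<i> * of_real (x \<bullet> \<xi>)) * gauss_weight z \<xi>)"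
    unfolding gauss_weight_product by (rule integrable_prod_coordinates[OF i])
  show "norm (gauss_kernel z x) \<le> (\<Prod>i\<in>UNIV. sqrt (pi / norm (z i)))"
    unfolding gauss_kernel_def gauss_weight_product integral_prod_coordinates[OF i] prod_norm[symmetric]
    by (intro prod_mono conjI norm_ge_zero gaussian_fourier_bound z)
qed

lemma gauss_weight_integrable:
  assumes z: "\<And>i. Re (z i) > 0"
  shows "integrable lborel (gauss_weight z)"
  using gauss_weight_exp_integrable[OF z, of 0] by simp

lemma gauss_kernel_real:
  fixes x :: "real^'n::finite"
  assumes a: "a > 0"
  shows "gauss_kernel (\<lambda>_. of_real a) x = of_real (sqrt (pi / a) ^ CARD('n) * exp (- (norm x)\<^sup>2 / (4 * a)))"
proof -
  have "gauss_kernel (\<lambda>_. of_real a) x = (\<Prod>i\<in>UNIV. of_real (sqrt (pi / a) * exp (- (x $ i)\<^sup>2 / (4 * a))))"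
    unfolding gauss_kernel_def gauss_weight_product
    using gaussian_integrable[of "of_real a"] gaussian_fourier_real[OF a] a
    by (subst integral_prod_coordinates) simp_all
  also have "\<dots> = of_real (sqrt (pi / a) ^ CARD('n) * exp (\<Sum>i\<in>UNIV. - (x $ i)\<^sup>2 / (4 * a)))"
    by (simp add: prod.distrib exp_sum)
  also have "(\<Sum>i\<in>UNIV. - (x $ i)\<^sup>2 / (4 * a)) = - (norm x)\<^sup>2 / (4 * a)"
    by (simp add: norm_vec_def L2_set_def sum_nonneg sum_negf sum_divide_distrib)
  finally show ?thesis .
qed

lemma gauss_weight_real:
  fixes x :: "real^'n::finite"
  shows "gauss_weight (\<lambda>_. of_real a) x = of_real (exp (- a * (norm x)\<^sup>2))"
  unfolding gauss_weight_def
  by (simp add: norm_vec_def L2_set_def sum_nonneg sum_distrib_left sum_negf flip: exp_of_real)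

lemma
  assumes a: "a > 0"
  shows integrable_gaussian_norm: "integrable lborel (\<lambda>x::real^'n::finite. exp (- a * (norm x)\<^sup>2))"
    and integral_gaussian_norm: "(LINT x|lborel. exp (- a * (norm (x::real^'n::finite))\<^sup>2)) = sqrt (pi / a) ^ CARD('n)"
proof -
  show i: "integrable lborel (\<lambda>x::real^'n::finite. exp (- a * (norm x)\<^sup>2))"
    using gauss_weight_integrable[of "\<lambda>_::'n. of_real a"] a
    unfolding gauss_weight_real[abs_def] complex_of_real_integrable_eq by simp
  have "(LINT x|lborel. complex_of_real (exp (- a * (norm (x::real^'n))\<^sup>2))) = gauss_kernel (\<lambda>_. of_real a) (0 :: real^'n)"
    unfolding gauss_kernel_def gauss_weight_real by simp
  also have "\<dots> = of_real (sqrt (pi / a) ^ CARD('n))"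
    unfolding gauss_kernel_real[OF a] by simp
  finally show "(LINT x|lborel. exp (- a * (norm (x::real^'n::finite))\<^sup>2)) = sqrt (pi / a) ^ CARD('n)"
    unfolding integral_complex_of_real by (simp only: of_real_eq_iff)
qed

section \<open>The Fourier transform: duality and inversion\<close>

lemma nn_integral_lborel_affine:
  fixes f :: "'a::euclidean_space \<Rightarrow> ennreal"
  assumes [measurable]: "f \<in> borel_measurable borel" and c: "c \<noteq> 0"
  shows "(\<integral>\<^sup>+x. f x \<partial>lborel) = ennreal (\<bar>c\<bar> ^ DIM('a)) * (\<integral>\<^sup>+x. f (t + c *\<^sub>R x) \<partial>lborel)"
  by (subst lborel_affine[OF c, of t])
     (simp add: nn_integral_density nn_integral_distr nn_integral_cmult)

lemma integral_lborel_affine: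
  fixes f :: "'a::euclidean_space \<Rightarrow> complex"
  assumes [measurable]: "f \<in> borel_measurable borel" and c: "c \<noteq> 0"
  shows "(LINT x|lborel. f x) = of_real (\<bar>c\<bar> ^ DIM('a)) * (LINT x|lborel. f (t + c *\<^sub>R x))"
  by (subst lborel_affine[OF c, of t])
     (simp add: integral_density integral_distr scaleR_conv_of_real)

lemma norm_exp_minus_i [simp]: "norm (exp (- \<i> * complex_of_real r)) = 1"
  using norm_exp_i_times[of "- r"] by simp

definition fourier_const :: "'n::finite itself \<Rightarrow> real" where
  "fourier_const _ = (2 * pi) powr (- real CARD('n) / 2)"

lemma fourier_const_pos: "fourier_const TYPE('n::finite) > 0"
  by (simp add: fourier_const_def)

lemma fourier_const_square: "(fourier_const TYPE('n::finite))\<^sup>2 = 1 / (2 * pi) ^ CARD('n)"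
proof -
  have "(fourier_const TYPE('n))\<^sup>2 = (2 * pi) powr (- real CARD('n) / 2 + - real CARD('n) / 2)"
    unfolding power2_eq_square fourier_const_def by (simp only: powr_add)
  also have "\<dots> = 1 / (2 * pi) ^ CARD('n)"
    by (simp add: powr_minus_divide powr_realpow)
  finally show ?thesis .
qed

lemma fourier_eq:
  "fourier f \<xi> = of_real (fourier_const TYPE('n::finite)) *
     (LINT x|lborel. exp (- \<i> * of_real (x \<bullet> (\<xi> :: real^'n))) * f x)"
  unfolding fourier_def fourier_const_def ..

lemma inv_fourier_eq: "inv_fourier g x = fourier g (- x)"
  unfolding inv_fourier_def fourier_def by (simp add: inner_commute)

text \<open>Multiplication by a character does not affect integrability, so the integral that defines the Fourier
transform of a function that is not integrable takes the default value 0 at every point. Hence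
continuity and boundedness of \<open>fourier f\<close> hold for all \<open>f\<close>.\<close>

lemma integrable_times_character:
  fixes f :: "real^'n::finite \<Rightarrow> complex"
  shows "integrable lborel (\<lambda>x. exp (- \<i> * of_real (x \<bullet> \<xi>)) * f x) \<longleftrightarrow> integrable lborel f"
proof
  assume i: "integrable lborel (\<lambda>x. exp (- \<i> * of_real (x \<bullet> \<xi>)) * f x)"
  have "(\<lambda>x. exp (\<i> * of_real (x \<bullet> \<xi>)) * (exp (- \<i> * of_real (x \<bullet> \<xi>)) * f x)) = f"
    by (simp add: fun_eq_iff exp_add[symmetric] mult.assoc[symmetric])
  moreover have "(\<lambda>x. exp (\<i> * of_real (x \<bullet> \<xi>)) * (exp (- \<i> * of_real (x \<bullet> \<xi>)) * f x)) \<in> borel_measurable lborel"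
    by (rule borel_measurable_times[OF _ borel_measurable_integrable[OF i]]) measurable
  ultimately have "f \<in> borel_measurable lborel" by (simp only:)
  then have [measurable]: "f \<in> borel_measurable borel" by simp
  show "integrable lborel f"
    by (rule Bochner_Integration.integrable_bound[OF i]) (simp_all add: norm_mult)
next
  assume i: "integrable lborel f"
  show "integrable lborel (\<lambda>x. exp (- \<i> * of_real (x \<bullet> \<xi>)) * f x)"
    by (rule Bochner_Integration.integrable_bound[OF i]) (use i in \<open>auto simp: norm_mult\<close>)
qed

lemma fourier_not_integrable:
  fixes f :: "real^'n::finite \<Rightarrow> complex"
  assumes "\<not> integrable lborel f"
  shows "fourier f \<xi> = 0"
  unfolding fourier_def
  using not_integrable_integral_eq[of lborel "\<lambda>x. exp (- \<i> * of_real (x \<bullet> \<xi>)) * f x"] assms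
  by (simp only: integrable_times_character not_False_eq_True mult_zero_right)

lemma fourier_bound:
  fixes f :: "real^'n::finite \<Rightarrow> complex"
  shows "norm (fourier f \<xi>) \<le> fourier_const TYPE('n) * (LINT x|lborel. norm (f x))"
proof -
  have "norm (LINT x|lborel. exp (- \<i> * of_real (x \<bullet> \<xi>)) * f x) \<le> (LINT x|lborel. norm (f x))"
    by (rule order_trans[OF integral_norm_bound]) (simp add: norm_mult)
  then show ?thesis
    using fourier_const_pos[where 'n='n] by (simp add: fourier_eq norm_mult)
qed

lemma continuous_on_fourier:
  fixes f :: "real^'n::finite \<Rightarrow> complex"
  shows "continuous_on UNIV (fourier f)"
proof (cases "integrable lborel f")
  case True
  then have [measurable]: "f \<in> borel_measurable borel" by auto
  have "continuous_on UNIV (\<lambda>\<xi>. LINT x|lborel. exp (- \<i> * of_real (x \<bullet> \<xi>)) * f x)"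
  proof (rule continuous_on_sequentiallyI)
    fix u :: "nat \<Rightarrow> real^'n" and a assume u: "u \<longlonglongrightarrow> a"
    show "(\<lambda>n. LINT x|lborel. exp (- \<i> * of_real (x \<bullet> u n)) * f x)
        \<longlonglongrightarrow> (LINT x|lborel. exp (- \<i> * of_real (x \<bullet> a)) * f x)"
    proof (rule integral_dominated_convergence[where w = "\<lambda>x. norm (f x)"])
      show "AE x in lborel. (\<lambda>n. exp (- \<i> * of_real (x \<bullet> u n)) * f x) \<longlonglongrightarrow> exp (- \<i> * of_real (x \<bullet> a)) * f x"
        using u by (intro AE_I2 tendsto_intros)
    qed (use True in \<open>auto simp: norm_mult\<close>)
  qed
  then show ?thesis unfolding fourier_def[abs_def] by (intro continuous_intros)
next
  case False
  then have "fourier f = (\<lambda>_. 0)" by (simp add: fun_eq_iff fourier_not_integrable)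
  then show ?thesis by simp
qed

lemma borel_measurable_fourier [measurable]:
  fixes f :: "real^'n::finite \<Rightarrow> complex"
  shows "fourier f \<in> borel_measurable borel"
  by (rule borel_measurable_continuous_onI[OF continuous_on_fourier])

lemma integrable_mult_fourier:
  fixes f w :: "real^'n::finite \<Rightarrow> complex"
  assumes "integrable lborel w"
  shows "integrable lborel (\<lambda>\<xi>. w \<xi> * fourier f \<xi>)"
proof (rule Bochner_Integration.integrable_bound)
  show "integrable lborel (\<lambda>\<xi>. (fourier_const TYPE('n) * (LINT x|lborel. norm (f x))) *\<^sub>R w \<xi>)"
    using assms by simp
  show "AE \<xi> in lborel. norm (w \<xi> * fourier f \<xi>) \<le> norm ((fourier_const TYPE('n) * (LINT x|lborel. norm (f x))) *\<^sub>R w \<xi>)"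
    using fourier_bound[of f] fourier_const_pos[where 'n='n]
    by (auto simp: norm_mult abs_mult mult.commute intro!: AE_I2 mult_left_mono)
qed (use assms in auto)

text \<open>Fubini applied to the double integral of \<open>w(\<xi>) exp (-i x\<cdot>\<xi>) f(x)\<close>. Every duality argument
below rests on this identity.\<close>

lemma fourier_multiplication_formula:
  fixes f w :: "real^'n::finite \<Rightarrow> complex"
  assumes w: "integrable lborel w" and f: "integrable lborel f"
  shows "(LINT \<xi>|lborel. w \<xi> * fourier f \<xi>) = (LINT x|lborel. fourier w x * f x)"
proof -
  have [measurable]: "f \<in> borel_measurable borel" "w \<in> borel_measurable borel" using w f by auto
  have i: "integrable (lborel \<Otimes>\<^sub>M lborel) (\<lambda>(\<xi>, x). w \<xi> * (exp (- \<i> * of_real (x \<bullet> \<xi>)) * f x))"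
    by (rule lborel_pair.integrable_dominated_by_product[OF integrable_norm[OF w] integrable_norm[OF f]])
       (auto simp: norm_mult)
  have "(LINT \<xi>|lborel. w \<xi> * fourier f \<xi>) = of_real (fourier_const TYPE('n)) *
     (LINT \<xi>|lborel. LINT x|lborel. w \<xi> * (exp (- \<i> * of_real (x \<bullet> \<xi>)) * f x))"
    unfolding fourier_eq integral_mult_right_zero mult.left_commute[of _ "of_real (fourier_const TYPE('n))"] ..
  also have "(LINT \<xi>|lborel. LINT x|lborel. w \<xi> * (exp (- \<i> * of_real (x \<bullet> \<xi>)) * f x))
      = (LINT x|lborel. LINT \<xi>|lborel. w \<xi> * (exp (- \<i> * of_real (x \<bullet> \<xi>)) * f x))"
    using lborel_pair.Fubini_integral[OF i] by simp
  also have "of_real (fourier_const TYPE('n)) * \<dots> = (LINT x|lborel. fourier w x * f x)"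
  proof -
    have "fourier w x * f x = of_real (fourier_const TYPE('n)) * (LINT \<xi>|lborel. w \<xi> * (exp (- \<i> * of_real (x \<bullet> \<xi>)) * f x))" for x
      unfolding fourier_eq mult.assoc integral_mult_left_zero[symmetric]
      by (simp only: ac_simps inner_commute)
    then show ?thesis by (simp only: integral_mult_right_zero)
  qed
  finally show ?thesis .
qed

lemma gauss_weight_integrable_character:
  fixes x :: "real^'n::finite"
  assumes z: "\<And>i. Re (z i) > 0"
  shows "integrable lborel (\<lambda>\<xi>. exp (\<i> * of_real (x \<bullet> \<xi>)) * gauss_weight z \<xi>)"
  using gauss_weight_exp_integrable[OF z, of "- x"] by simp

lemma fourier_modulated_gauss_weight:
  fixes x y :: "real^'n::finite"
  shows "fourier (\<lambda>\<xi>. exp (\<i> * of_real (x \<bullet> \<xi>)) * gauss_weight z \<xi>) y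
    = of_real (fourier_const TYPE('n)) * gauss_kernel z (y - x)"
proof -
  have "exp (- \<i> * of_real (\<xi> \<bullet> y)) * (exp (\<i> * of_real (x \<bullet> \<xi>)) * gauss_weight z \<xi>)
      = exp (- \<i> * of_real ((y - x) \<bullet> \<xi>)) * gauss_weight z \<xi>" for \<xi>
    unfolding mult.assoc[symmetric] exp_add[symmetric]
    by (simp add: inner_diff_left inner_diff_right inner_commute right_diff_distrib)
  then show ?thesis unfolding fourier_eq gauss_kernel_def by (simp only:)
qed

lemma cnj_gauss_weight: "cnj (gauss_weight z \<xi>) = gauss_weight (\<lambda>i. cnj (z i)) \<xi>"
  unfolding gauss_weight_def by (simp add: exp_cnj)

text \<open>Applying the multiplication formula twice turns a Gaussian-weighted energy of the Fourier transform of
\<open>G\<close> into the quadratic form of \<open>G\<close> with kernel \<open>gauss_kernel\<close>; the claim is Schur's test for that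
form.\<close>

lemma gauss_weighted_energy_bound:
  fixes G :: "real^'n::finite \<Rightarrow> complex"
  assumes z: "\<And>i. Re (z i) > 0" and G: "integrable lborel G"
    and B: "\<And>x. (LINT y|lborel. norm (gauss_kernel (\<lambda>i. cnj (z i)) (y - x) * G y)) \<le> B"
  shows "norm (LINT \<xi>|lborel. gauss_weight z \<xi> * of_real ((norm (fourier G \<xi>))\<^sup>2))
    \<le> B * (LINT x|lborel. norm (G x)) / (2 * pi) ^ CARD('n)"
proof -
  let ?c = "fourier_const TYPE('n)"
  define w where "w = (\<lambda>\<xi>. gauss_weight z \<xi> * cnj (fourier G \<xi>))"
  have wi: "integrable lborel w"
    using integrable_mult_fourier[OF gauss_weight_integrable[of "\<lambda>i. cnj (z i)"], of G] z
    unfolding w_def by (subst complex_integrable_cnj[symmetric]) (simp add: cnj_gauss_weight)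
  have "(LINT \<xi>|lborel. gauss_weight z \<xi> * of_real ((norm (fourier G \<xi>))\<^sup>2)) = (LINT \<xi>|lborel. w \<xi> * fourier G \<xi>)"
    unfolding w_def complex_norm_square by (simp only: ac_simps)
  also have "\<dots> = (LINT x|lborel. fourier w x * G x)"
    by (rule fourier_multiplication_formula[OF wi G])
  also have "norm \<dots> \<le> (LINT x|lborel. norm (fourier w x * G x))"
    by (rule integral_norm_bound)
  also have "\<dots> \<le> (LINT x|lborel. ?c\<^sup>2 * B * norm (G x))"
  proof (rule integral_mono)
    fix x
    define v where "v = (\<lambda>\<xi>. exp (\<i> * of_real (x \<bullet> \<xi>)) * gauss_weight (\<lambda>i. cnj (z i)) \<xi>)"
    have vi: "integrable lborel v"
      unfolding v_def by (rule gauss_weight_integrable_character) (use z in simp)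
    have "fourier w x = of_real ?c * cnj (LINT \<xi>|lborel. v \<xi> * fourier G \<xi>)"
    proof -
      have "exp (- \<i> * of_real (\<xi> \<bullet> x)) * w \<xi> = cnj (v \<xi> * fourier G \<xi>)" for \<xi>
        by (simp add: w_def v_def exp_cnj cnj_gauss_weight inner_commute)
      then show ?thesis unfolding fourier_eq[of w] by (simp only: Bochner_Integration.integral_cnj)
    qed
    also have "(LINT \<xi>|lborel. v \<xi> * fourier G \<xi>) = (LINT y|lborel. fourier v y * G y)"
      by (rule fourier_multiplication_formula[OF vi G])
    also have "\<dots> = (LINT y|lborel. of_real ?c * (gauss_kernel (\<lambda>i. cnj (z i)) (y - x) * G y))"
      unfolding v_def fourier_modulated_gauss_weight by (simp add: mult.assoc)
    finally have "fourier w x = of_real (?c\<^sup>2) * cnj (LINT y|lborel. gauss_kernel (\<lambda>i. cnj (z i)) (y - x) * G y)"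
      by (simp add: power2_eq_square)
    then have "norm (fourier w x) = ?c\<^sup>2 * norm (LINT y|lborel. gauss_kernel (\<lambda>i. cnj (z i)) (y - x) * G y)"
      by (simp add: norm_mult norm_power)
    also have "\<dots> \<le> ?c\<^sup>2 * B"
      by (intro mult_left_mono order_trans[OF integral_norm_bound B]) simp
    finally show "norm (fourier w x * G x) \<le> ?c\<^sup>2 * B * norm (G x)"
      by (simp add: norm_mult mult_right_mono)
  qed (use integrable_mult_fourier[OF G, of w] G in \<open>auto simp: mult.commute\<close>)
  finally show ?thesis by (simp add: fourier_const_square)
qed

text \<open>The usual proof: damp the outer integral by a Gaussian of width \<open>1/s\<close>, move the Fourier transform onto
the Gaussian, and let \<open>s\<close> tend to 0. On one side dominated convergence applies because the inverse
transform is integrable, on the other side the Gaussians form an approximate identity.\<close>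

lemma fourier_inversion:
  fixes g :: "real^'n::finite \<Rightarrow> complex"
  assumes gc: "continuous_on UNIV g" and gi: "integrable lborel g" and gb: "\<And>x. norm (g x) \<le> B"
    and hi: "integrable lborel (inv_fourier g)"
  shows "fourier (inv_fourier g) \<xi> = g \<xi>"
proof -
  let ?c = "fourier_const TYPE('n)" and ?h = "inv_fourier g"
  have [measurable]: "g \<in> borel_measurable borel" "?h \<in> borel_measurable borel" using gi hi by auto
  define w where "w = (\<lambda>s x. exp (\<i> * of_real (\<xi> \<bullet> x)) * gauss_weight (\<lambda>_. of_real (s\<^sup>2)) x)"
  have id: "of_real ?c * (LINT x|lborel. w s (- x) * ?h x) =
     of_real (1 / (2 * pi) ^ CARD('n) * sqrt pi ^ CARD('n)) * (LINT u|lborel. of_real (exp (- (norm u)\<^sup>2 / 4)) * g (\<xi> + s *\<^sub>R u))"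
    if s: "s > 0" for s
  proof -
    have wi: "integrable lborel (w s)"
      unfolding w_def by (rule gauss_weight_integrable_character) (use s in simp)
    have "(LINT x|lborel. w s (- x) * ?h x) = (LINT x|lborel. w s x * fourier g x)"
      by (subst integral_lborel_affine[of _ "-1" 0]) (auto simp: inv_fourier_eq w_def)
    also have "\<dots> = (LINT \<eta>|lborel. fourier (w s) \<eta> * g \<eta>)"
      by (rule fourier_multiplication_formula[OF wi gi])
    also have "\<dots> = (LINT \<eta>|lborel. of_real ?c * of_real (sqrt (pi / s\<^sup>2) ^ CARD('n) * exp (- (norm (\<eta> - \<xi>))\<^sup>2 / (4 * s\<^sup>2))) * g \<eta>)"
      unfolding w_def fourier_modulated_gauss_weight using s by (subst gauss_kernel_real) auto
    also have "\<dots> = of_real (s ^ CARD('n)) * (LINT u|lborel. of_real ?c * of_real (sqrt (pi / s\<^sup>2) ^ CARD('n) * exp (- (norm u)\<^sup>2 / 4)) * g (\<xi> + s *\<^sub>R u))"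
      using s by (subst integral_lborel_affine[of _ s \<xi>]) (auto simp: power_mult_distrib)
    also have "\<dots> = of_real (?c * sqrt pi ^ CARD('n)) * (LINT u|lborel. of_real (exp (- (norm u)\<^sup>2 / 4)) * g (\<xi> + s *\<^sub>R u))"
      unfolding integral_mult_right_zero[symmetric]
      by (rule Bochner_Integration.integral_cong[OF refl]) (use s in \<open>simp add: real_sqrt_divide power_divide\<close>)
    finally have "of_real ?c * (LINT x|lborel. w s (- x) * ?h x) =
       of_real (?c\<^sup>2 * sqrt pi ^ CARD('n)) * (LINT u|lborel. of_real (exp (- (norm u)\<^sup>2 / 4)) * g (\<xi> + s *\<^sub>R u))"
      by (simp add: power2_eq_square)
    then show ?thesis unfolding fourier_const_square .
  qed
  \<comment> \<open>Dominated convergence is applied along the sequence \<open>s = \<sigma> n\<close>, once on each side of the identity.\<close>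
  define \<sigma> where "\<sigma> n = 1 / real (Suc n)" for n
  have \<sigma>: "\<sigma> n > 0" "\<sigma> \<longlonglongrightarrow> 0" for n
    unfolding \<sigma>_def[abs_def] using LIMSEQ_inverse_real_of_nat by (auto simp: inverse_eq_divide)
  have "(\<lambda>n. LINT x|lborel. w (\<sigma> n) (- x) * ?h x) \<longlonglongrightarrow> (LINT x|lborel. exp (- \<i> * of_real (x \<bullet> \<xi>)) * ?h x)"
  proof (rule integral_dominated_convergence[where w = "\<lambda>x. norm (?h x)"])
    have "(\<lambda>n. w (\<sigma> n) (- x) * ?h x) \<longlonglongrightarrow> exp (\<i> * of_real (\<xi> \<bullet> (- x))) * of_real (exp (- 0\<^sup>2 * (norm (- x))\<^sup>2)) * ?h x" for x
      unfolding w_def gauss_weight_real using \<sigma>(2) by (intro tendsto_intros)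
    then show "AE x in lborel. (\<lambda>n. w (\<sigma> n) (- x) * ?h x) \<longlonglongrightarrow> exp (- \<i> * of_real (x \<bullet> \<xi>)) * ?h x"
      by (simp add: inner_commute)
    show "AE x in lborel. norm (w (\<sigma> n) (- x) * ?h x) \<le> norm (?h x)" for n
      unfolding w_def gauss_weight_real by (auto simp: norm_mult intro!: AE_I2 mult_left_le_one_le)
  qed (use hi in \<open>auto simp: w_def\<close>)
  then have l1: "(\<lambda>n. of_real ?c * (LINT x|lborel. w (\<sigma> n) (- x) * ?h x)) \<longlonglongrightarrow> fourier ?h \<xi>"
    unfolding fourier_eq by (rule tendsto_mult_left)
  have gi4: "integrable lborel (\<lambda>u::real^'n. exp (- (norm u)\<^sup>2 / 4))"
    using integrable_gaussian_norm[of "1/4"] by simp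
  have "(\<lambda>n. LINT u|lborel. of_real (exp (- (norm u)\<^sup>2 / 4)) * g (\<xi> + \<sigma> n *\<^sub>R u)) \<longlonglongrightarrow>
     (LINT u|(lborel :: (real^'n) measure). of_real (exp (- (norm u)\<^sup>2 / 4)) * g \<xi>)"
  proof (rule integral_dominated_convergence[where w = "\<lambda>u::real^'n. B * exp (- (norm u)\<^sup>2 / 4)"])
    have "(\<lambda>n. \<xi> + \<sigma> n *\<^sub>R u) \<longlonglongrightarrow> \<xi> + 0 *\<^sub>R u" for u
      using \<sigma>(2) by (intro tendsto_intros)
    then have "(\<lambda>n. g (\<xi> + \<sigma> n *\<^sub>R u)) \<longlonglongrightarrow> g \<xi>" for u
      using continuous_on_tendsto_compose[OF gc, of _ \<xi> sequentially] by simp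
    then show "AE u in lborel. (\<lambda>n. of_real (exp (- (norm u)\<^sup>2 / 4)) * g (\<xi> + \<sigma> n *\<^sub>R u)) \<longlonglongrightarrow> of_real (exp (- (norm u)\<^sup>2 / 4)) * g \<xi>"
      by (intro AE_I2 tendsto_intros)
  qed (use gi4 gb in \<open>auto simp: norm_mult mult.commute intro!: AE_I2 mult_left_mono\<close>)
  also have "(LINT u|(lborel :: (real^'n) measure). of_real (exp (- (norm u)\<^sup>2 / 4)) * g \<xi>) = of_real (sqrt (pi * 4) ^ CARD('n)) * g \<xi>"
    using integral_gaussian_norm[of "1/4", where 'n='n] by (simp flip: of_real_power)
  finally have "(\<lambda>n. of_real (1 / (2 * pi) ^ CARD('n) * sqrt pi ^ CARD('n)) *
       (LINT u|lborel. of_real (exp (- (norm u)\<^sup>2 / 4)) * g (\<xi> + \<sigma> n *\<^sub>R u)))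
     \<longlonglongrightarrow> of_real (1 / (2 * pi) ^ CARD('n) * sqrt pi ^ CARD('n)) * (of_real (sqrt (pi * 4) ^ CARD('n)) * g \<xi>)"
    by (rule tendsto_mult_left)
  also have "of_real (1 / (2 * pi) ^ CARD('n) * sqrt pi ^ CARD('n)) * (of_real (sqrt (pi * 4) ^ CARD('n)) * g \<xi>) = g \<xi>"
  proof -
    have "sqrt pi ^ CARD('n) * sqrt (pi * 4) ^ CARD('n) = (2 * pi) ^ CARD('n)"
      unfolding power_mult_distrib[symmetric]
      by (rule arg_cong[where f = "\<lambda>x. x ^ CARD('n)"]) (simp add: real_sqrt_mult)
    then have "1 / (2 * pi) ^ CARD('n) * sqrt pi ^ CARD('n) * sqrt (pi * 4) ^ CARD('n) = 1" by simp
    then have "complex_of_real (1 / (2 * pi) ^ CARD('n) * sqrt pi ^ CARD('n)) * of_real (sqrt (pi * 4) ^ CARD('n)) = 1"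
      unfolding of_real_mult[symmetric] by (simp only: of_real_1)
    then show ?thesis unfolding mult.assoc[symmetric] by simp
  qed
  finally have "(\<lambda>n. of_real ?c * (LINT x|lborel. w (\<sigma> n) (- x) * ?h x)) \<longlonglongrightarrow> g \<xi>"
    unfolding id[OF \<sigma>(1)] .
  with l1 show ?thesis by (rule LIMSEQ_unique)
qed

section \<open>Gaussian energies of the Fourier transform\<close>

lemma integrable_of_le_indicator:
  fixes G :: "'a::euclidean_space \<Rightarrow> complex"
  assumes "G \<in> borel_measurable borel" "E \<in> sets borel" "emeasure lborel E < \<infinity>"
    and "\<And>x. norm (G x) \<le> indicator E x"
  shows "integrable lborel G" "(LINT x|lborel. norm (G x)) \<le> measure lborel E"
proof -
  have i: "integrable lborel (indicator E :: 'a \<Rightarrow> real)" using assms by simp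
  show "integrable lborel G"
    by (rule Bochner_Integration.integrable_bound[OF i]) (use assms in auto)
  then have "(LINT x|lborel. norm (G x)) \<le> (LINT x|lborel. indicator E x)"
    by (intro integral_mono i integrable_norm) (use assms in auto)
  then show "(LINT x|lborel. norm (G x)) \<le> measure lborel E" by simp
qed

text \<open>The bound by \<open>L\<^sup>1\<close> norms: the kernel is bounded by \<open>\<Prod> (\<pi>/|z\<^sub>i|)\<^bsup>1/2\<^esup>\<close>, and the powers of \<open>\<pi>\<close> are absorbed
by the normalisation of the Fourier transform.\<close>

lemma gauss_energy_dispersive:
  fixes G :: "real^'n::finite \<Rightarrow> complex"
  assumes z: "\<And>i. Re (z i) \<ge> 1" and G: "integrable lborel G"
    and V: "(LINT x|lborel. norm (G x)) \<le> V"
  shows "norm (LINT \<xi>|lborel. gauss_weight z \<xi> * of_real ((norm (fourier G \<xi>))\<^sup>2))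
    \<le> (\<Prod>i\<in>UNIV. norm (z i) powr (-1/2)) * V\<^sup>2"
proof -
  have z0: "Re (z i) > 0" for i using z[of i] by linarith
  have nz: "norm (z i) > 0" for i using z0[of i] complex_Re_le_cmod[of "z i"] by linarith
  have Vp: "V \<ge> 0" using V by (rule order_trans[rotated]) simp
  define P where "P = (\<Prod>i\<in>UNIV. sqrt (pi / norm (z i)))"
  have P: "P \<ge> 0" unfolding P_def by (intro prod_nonneg) auto
  have "norm (LINT \<xi>|lborel. gauss_weight z \<xi> * of_real ((norm (fourier G \<xi>))\<^sup>2))
    \<le> (P * V) * (LINT x|lborel. norm (G x)) / (2 * pi) ^ CARD('n)"
  proof (rule gauss_weighted_energy_bound[OF z0 G])
    fix x
    have "(LINT y|lborel. norm (gauss_kernel (\<lambda>i. cnj (z i)) (y - x) * G y)) \<le> (LINT y|lborel. P * norm (G y))"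
    proof (rule Bochner_Integration.integral_mono')
      have "norm (gauss_kernel (\<lambda>i. cnj (z i)) (y - x)) \<le> P" for y
        using gauss_kernel_bound[of "\<lambda>i. cnj (z i)" "y - x"] z0 by (simp add: P_def)
      then show "norm (gauss_kernel (\<lambda>i. cnj (z i)) (y - x) * G y) \<le> P * norm (G y)" for y
        by (simp add: norm_mult mult_right_mono)
    qed (use G P in auto)
    also have "\<dots> \<le> P * V" using P V by (simp add: mult_left_mono)
    finally show "(LINT y|lborel. norm (gauss_kernel (\<lambda>i. cnj (z i)) (y - x) * G y)) \<le> P * V" .
  qed
  also have "\<dots> \<le> (P * V) * V / (2 * pi) ^ CARD('n)"
    using V Vp P by (intro divide_right_mono mult_left_mono) auto
  also have "\<dots> = P / (2 * pi) ^ CARD('n) * V\<^sup>2" by (simp add: power2_eq_square)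
  also have "P / (2 * pi) ^ CARD('n) = (\<Prod>i\<in>UNIV. sqrt (pi / norm (z i)) / (2 * pi))"
    by (simp add: P_def prod_dividef)
  also have "\<dots> \<le> (\<Prod>i\<in>UNIV. norm (z i) powr (-1/2))"
  proof (intro prod_mono conjI)
    fix i
    have "sqrt pi \<le> 2 * pi" using pi_ge_two by (intro real_le_lsqrt) (auto simp: power2_eq_square)
    then have "sqrt pi / (2 * pi) * (1 / sqrt (norm (z i))) \<le> 1 * (1 / sqrt (norm (z i)))"
      by (intro mult_right_mono) auto
    also have "1 * (1 / sqrt (norm (z i))) = norm (z i) powr (-1/2)"
      using nz[of i] by (simp add: powr_minus_divide powr_half_sqrt)
    finally show "sqrt (pi / norm (z i)) / (2 * pi) \<le> norm (z i) powr (-1/2)"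
      by (simp add: real_sqrt_divide mult.commute)
  qed auto
  finally show ?thesis by (simp add: mult_right_mono)
qed

lemma fourier_sq_gauss_integrable:
  fixes G :: "real^'n::finite \<Rightarrow> complex"
  assumes z: "\<And>i. Re (z i) > 0"
  shows "integrable lborel (\<lambda>\<xi>. gauss_weight z \<xi> * of_real ((norm (fourier G \<xi>))\<^sup>2))"
proof -
  have "gauss_weight z \<xi> * of_real ((norm (fourier G \<xi>))\<^sup>2) = cnj (cnj (gauss_weight z \<xi> * fourier G \<xi>) * fourier G \<xi>)" for \<xi>
    unfolding complex_norm_square by simp
  moreover have "integrable lborel (\<lambda>\<xi>. cnj (cnj (gauss_weight z \<xi> * fourier G \<xi>) * fourier G \<xi>))"
    by (intro integrable_cnj integrable_mult_fourier gauss_weight_integrable z)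
  ultimately show ?thesis by (simp only:)
qed

lemma fourier_sq_gaussian_integrable:
  fixes G :: "real^'n::finite \<Rightarrow> complex"
  shows "integrable lborel (\<lambda>\<xi>. exp (- (norm \<xi>)\<^sup>2) * (norm (fourier G \<xi>))\<^sup>2)"
proof -
  have "integrable lborel (\<lambda>\<xi>. complex_of_real (exp (- (norm \<xi>)\<^sup>2) * (norm (fourier G \<xi>))\<^sup>2))"
    using fourier_sq_gauss_integrable[of "\<lambda>_. of_real 1" G] unfolding gauss_weight_real by simp
  then show ?thesis unfolding complex_of_real_integrable_eq .
qed

lemma
  fixes f :: "'a::euclidean_space \<Rightarrow> 'b::{banach, second_countable_topology}"
  assumes "integrable lborel f"
  shows integrable_lborel_diff: "integrable lborel (\<lambda>y. f (y - x))"
    and integral_lborel_diff: "(LINT y|lborel. f (y - x)) = (LINT y|lborel. f y)"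
proof -
  have [measurable]: "f \<in> borel_measurable borel" using assms by simp
  have "integrable (distr lborel borel ((+) (- x))) f" unfolding lborel_distr_plus by fact
  then show "integrable lborel (\<lambda>y. f (y - x))" by (subst (asm) integrable_distr_eq) auto
  have "(LINT y|lborel. f y) = (LINT y|distr lborel borel ((+) (- x)). f y)" unfolding lborel_distr_plus ..
  also have "\<dots> = (LINT y|lborel. f (y - x))" by (subst integral_distr) auto
  finally show "(LINT y|lborel. f (y - x)) = (LINT y|lborel. f y)" ..
qed

text \<open>An upper bound of Plancherel type, for functions bounded by 1: the kernel of the weight \<open>exp (-|\<xi>|\<^sup>2)\<close> is
nonnegative with total mass \<open>(2\<pi>)\<^sup>d\<close>, so Schur's test has constant 1.\<close>

lemma gauss_energy_plancherel:
  fixes G :: "real^'n::finite \<Rightarrow> complex"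
  assumes G: "integrable lborel G" and G1: "\<And>x. norm (G x) \<le> 1"
    and V: "(LINT x|lborel. norm (G x)) \<le> V"
  shows "(LINT \<xi>|lborel. exp (- (norm \<xi>)\<^sup>2) * (norm (fourier G \<xi>))\<^sup>2) \<le> V"
proof -
  let ?z = "\<lambda>_::'n. complex_of_real 1"
  have k: "gauss_kernel (\<lambda>i. cnj (?z i)) x = of_real (sqrt pi ^ CARD('n) * exp (- (norm x)\<^sup>2 / 4))" for x
    using gauss_kernel_real[of 1 x] by simp
  have gi4: "integrable lborel (\<lambda>u::real^'n. exp (- (norm u)\<^sup>2 / 4))"
    using integrable_gaussian_norm[of "1/4"] by simp
  have I4: "(LINT u|lborel. exp (- (norm (u :: real^'n))\<^sup>2 / 4)) = sqrt (pi * 4) ^ CARD('n)"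
    using integral_gaussian_norm[of "1/4", where 'n='n] by simp
  have "complex_of_real (LINT \<xi>|lborel. exp (- (norm \<xi>)\<^sup>2) * (norm (fourier G \<xi>))\<^sup>2)
     = (LINT \<xi>|lborel. gauss_weight ?z \<xi> * of_real ((norm (fourier G \<xi>))\<^sup>2))"
    unfolding integral_complex_of_real[symmetric] gauss_weight_real by simp
  then have "\<bar>LINT \<xi>|lborel. exp (- (norm \<xi>)\<^sup>2) * (norm (fourier G \<xi>))\<^sup>2\<bar>
     = norm (LINT \<xi>|lborel. gauss_weight ?z \<xi> * of_real ((norm (fourier G \<xi>))\<^sup>2))"
    unfolding norm_of_real[symmetric, where 'a=complex] by (rule arg_cong)
  also have "\<dots> \<le> (2 * pi) ^ CARD('n) * (LINT x|lborel. norm (G x)) / (2 * pi) ^ CARD('n)"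
  proof (rule gauss_weighted_energy_bound)
    fix x
    have gx: "integrable lborel (\<lambda>y::real^'n. exp (- (norm (y - x))\<^sup>2 / 4))"
      by (rule integrable_lborel_diff[OF gi4])
    have "(LINT y|lborel. norm (gauss_kernel (\<lambda>i. cnj (?z i)) (y - x) * G y))
      \<le> (LINT y|lborel. sqrt pi ^ CARD('n) * exp (- (norm (y - x))\<^sup>2 / 4))"
    proof (rule integral_mono')
      show "integrable lborel (\<lambda>y. sqrt pi ^ CARD('n) * exp (- (norm (y - x))\<^sup>2 / 4))"
        by (intro integrable_mult_right gx)
      show "norm (gauss_kernel (\<lambda>i. cnj (?z i)) (y - x) * G y) \<le> sqrt pi ^ CARD('n) * exp (- (norm (y - x))\<^sup>2 / 4)" for y
        unfolding k norm_mult norm_of_real using G1[of y]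
        by (simp add: mult_left_le)
    qed auto
    also have "\<dots> = sqrt pi ^ CARD('n) * (LINT y|lborel. exp (- (norm (y :: real^'n))\<^sup>2 / 4))"
      using integral_lborel_diff[OF gi4, of x] by simp
    also have "\<dots> = (2 * pi) ^ CARD('n)"
      unfolding I4 power_mult_distrib[symmetric]
      by (rule arg_cong[where f = "\<lambda>x. x ^ CARD('n)"]) (simp add: real_sqrt_mult)
    finally show "(LINT y|lborel. norm (gauss_kernel (\<lambda>i. cnj (?z i)) (y - x) * G y)) \<le> (2 * pi) ^ CARD('n)" .
  qed (use G in auto)
  finally show ?thesis using V abs_ge_self[of "LINT \<xi>|lborel. exp (- (norm \<xi>)\<^sup>2) * (norm (fourier G \<xi>))\<^sup>2"] by simp
qed

section \<open>The singular weight as an average of Gaussians\<close>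

lemma char_std_normal_lborel:
  "(LINT s|lborel. of_real (std_normal_density s) * exp (\<i> * of_real (\<sigma> * s))) = complex_of_real (exp (- \<sigma>\<^sup>2 / 2))"
proof -
  have "(LINT s|lborel. of_real (std_normal_density s) * exp (\<i> * of_real (\<sigma> * s))) = char std_normal_distribution \<sigma>"
    unfolding char_def by (subst integral_density) (auto simp: scaleR_conv_of_real)
  then show ?thesis by (simp add: char_std_normal_distribution)
qed

text \<open>The dispersive bound degenerates as \<open>s\<close> tends to 0; this says that averaging over \<open>s\<close> tolerates the
singularity \<open>|s|\<^bsup>-A\<^esup>\<close>.\<close>

lemma integrable_std_normal_neg_powr:
  assumes A: "0 \<le> A" "A < 1"
  shows "integrable lborel (\<lambda>s. std_normal_density s * \<bar>s\<bar> powr (- A))"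
proof -
  define f where "f s = indicator {0..1} s * s powr (- A)" for s :: real
  have "((\<lambda>x. x powr (- A)) has_integral (1 powr (- A + 1) / (- A + 1))) {0..1}"
    using A by (intro has_integral_powr_from_0) auto
  then have "(\<integral>\<^sup>+s. ennreal (f s) \<partial>lborel) = ennreal (1 powr (- A + 1) / (- A + 1))"
    unfolding f_def by (intro nn_integral_has_integral_lebesgue[rotated]) auto
  moreover have "f \<in> borel_measurable borel" unfolding f_def by measurable
  ultimately have fi: "integrable lborel f"
    by (intro integrableI_nn_integral_finite[where x = "1 powr (- A + 1) / (- A + 1)"])
       (use A in \<open>auto simp: f_def\<close>)
  have fm: "integrable lborel (\<lambda>s. f (0 + (-1) * s))"
    by (rule lborel_integrable_real_affine[OF fi]) simp
  have "integrable lborel (\<lambda>s. std_normal_density s + (f s + f (0 + (-1) * s)))"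
    by (intro Bochner_Integration.integrable_add integrable_normal_density fi fm) auto
  then show ?thesis
  proof (rule Bochner_Integration.integrable_bound)
    have "std_normal_density s * \<bar>s\<bar> powr (- A) \<le> std_normal_density s + (f s + f (0 + (-1) * s))" for s
    proof (cases "\<bar>s\<bar> \<le> 1")
      case True
      have "1 \<le> sqrt (2 * pi)" using pi_ge_two by simp
      then have "1 / sqrt (2 * pi) * exp (- s\<^sup>2 / 2) \<le> 1 * 1"
        by (intro mult_mono) (auto simp: field_simps)
      then have "std_normal_density s * \<bar>s\<bar> powr (- A) \<le> \<bar>s\<bar> powr (- A)"
        by (intro mult_left_le_one_le) (auto simp: std_normal_density_def)
      also have "\<dots> \<le> f s + f (0 + (-1) * s)"
        using True by (auto simp: f_def indicator_def)
      finally show ?thesis using normal_density_nonneg[of 0 1 s] by linarith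
    next
      case False
      then have "\<bar>s\<bar> powr (- A) \<le> \<bar>s\<bar> powr 0" using A by (intro powr_mono) auto
      also have "\<dots> = 1" using False by auto
      finally have "std_normal_density s * \<bar>s\<bar> powr (- A) \<le> std_normal_density s"
        by (intro mult_left_le) auto
      moreover have "0 \<le> f s + f (0 + (-1) * s)" by (simp add: f_def)
      ultimately show ?thesis by linarith
    qed
    then show "AE s in lborel. norm (std_normal_density s * \<bar>s\<bar> powr (- A)) \<le> norm (std_normal_density s + (f s + f (0 + (-1) * s)))"
      by (intro AE_I2) (simp add: f_def abs_mult)
  qed simp
qed

text \<open>The weighted geometric mean of two bounds for one number. Applied to the energy of a function of size 1
on a set, it plays the part of the interpolation of operators between \<open>L\<^sup>1\<close> and \<open>L\<^sup>2\<close>.\<close>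

lemma powr_interpolation:
  fixes x V b \<theta> :: real
  assumes "0 \<le> x" "x \<le> V" "x \<le> b * V\<^sup>2" "0 \<le> b" "0 \<le> \<theta>" "\<theta> \<le> 1"
  shows "x \<le> b powr \<theta> * V powr (1 + \<theta>)"
proof (cases "x = 0")
  case False
  then have x: "x > 0" "V > 0" "b > 0" using assms by (auto simp: order_less_le)
  have "x = x powr (1 - \<theta>) * x powr \<theta>" using x by (simp flip: powr_add)
  also have "\<dots> \<le> V powr (1 - \<theta>) * (b * V\<^sup>2) powr \<theta>"
    using assms x by (intro mult_mono powr_mono2) auto
  also have "(b * V\<^sup>2) powr \<theta> = b powr \<theta> * V powr (2 * \<theta>)"
    using x by (simp add: powr_mult powr_powr flip: powr_numeral)
  also have "V powr (1 - \<theta>) * (b powr \<theta> * V powr (2 * \<theta>)) = b powr \<theta> * V powr (1 + \<theta>)"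
    using x by (simp add: mult.left_commute add.commute flip: powr_add)
  finally show ?thesis .
qed simp

lemma borel_measurable_q_symbol [measurable]: "q_symbol e \<tau> \<in> borel_measurable borel"
  unfolding q_symbol_def[abs_def] by measurable

lemma norm_q_symbol_square: "(norm (q_symbol e 1 \<xi>))\<^sup>2 = ((norm \<xi>)\<^sup>2 - 1)\<^sup>2 + 4 * (\<xi> $ e)\<^sup>2"
  unfolding cmod_power2 q_symbol_def by (simp add: power2_eq_square algebra_simps)

text \<open>The parameters for which \<open>gauss_weight\<close> is, up to a constant phase,
\<open>exp (i\<surd>2 r s (|\<xi>|\<^sup>2 - 1)) exp (-4r\<^sup>2\<xi>\<^sub>e\<^sup>2) exp (-|\<xi>|\<^sup>2)\<close>: averaged over a standard normal \<open>s\<close>, this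
becomes \<open>exp (-r\<^sup>2|q|\<^sup>2) exp (-|\<xi>|\<^sup>2)\<close>.\<close>

definition osc_exponent :: "'n::finite \<Rightarrow> real \<Rightarrow> real \<Rightarrow> 'n \<Rightarrow> complex" where
  "osc_exponent e r s i = Complex (1 + (if i = e then 4 * r\<^sup>2 else 0)) (- (sqrt 2 * r * s))"

lemma gauss_weight_osc:
  "exp (- \<i> * of_real (sqrt 2 * r * s)) * gauss_weight (osc_exponent e r s) \<xi>
   = exp (\<i> * of_real (sqrt 2 * r * ((norm \<xi>)\<^sup>2 - 1) * s)) * of_real (exp (- 4 * r\<^sup>2 * (\<xi> $ e)\<^sup>2 - (norm \<xi>)\<^sup>2))"
proof -
  have n: "(norm \<xi>)\<^sup>2 = (\<Sum>i\<in>UNIV. (\<xi> $ i)\<^sup>2)"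
    by (simp add: norm_vec_def L2_set_def sum_nonneg)
  have "(\<Sum>i\<in>UNIV. osc_exponent e r s i * of_real ((\<xi> $ i)\<^sup>2)) =
     Complex ((norm \<xi>)\<^sup>2 + 4 * r\<^sup>2 * (\<xi> $ e)\<^sup>2) (- (sqrt 2 * r * s) * (norm \<xi>)\<^sup>2)"
  proof -
    have "(\<Sum>i\<in>UNIV. (\<xi> $ i)\<^sup>2 * (if i = e then 4 * r\<^sup>2 else 0)) = 4 * r\<^sup>2 * (\<xi> $ e)\<^sup>2"
      by (simp add: if_distrib[of "\<lambda>x. _ * x"] cong: if_cong)
    then show ?thesis
      unfolding osc_exponent_def n complex_eq_iff
      by (simp add: sum_distrib_left algebra_simps sum.distrib sum_negf)
  qed
  then show ?thesis
    unfolding gauss_weight_def exp_of_real[symmetric] exp_add[symmetric]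
    by (intro arg_cong[where f = exp]) (simp add: complex_eq_iff algebra_simps)
qed


lemma borel_measurable_vec_nth_compose [measurable (raw)]:
  fixes f :: "'a \<Rightarrow> real^'n::finite"
  assumes "f \<in> borel_measurable M"
  shows "(\<lambda>x. f x $ i) \<in> borel_measurable M"
  using assms by (rule borel_measurable_continuous_on[rotated]) (intro continuous_intros)

text \<open>The weight \<open>exp (-r\<^sup>2|q|\<^sup>2) exp (-|\<xi>|\<^sup>2)\<close> is written as an average of complex Gaussians. For each of
them the energy obeys the dispersive and the Plancherel bound, hence their geometric mean. The function
\<open>h\<close> is a bound for the dispersive factor to the power \<open>\<theta>\<close>; in the main case it is a negative power of
\<open>|s|\<close>, whose value 0 at \<open>s = 0\<close> is no bound, so the point \<open>s = 0\<close> is exempted.\<close>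

lemma averaged_gauss_energy:
  fixes G :: "real^'n::finite \<Rightarrow> complex"
  assumes G: "integrable lborel G" and G1: "\<And>x. norm (G x) \<le> 1"
    and V: "(LINT x|lborel. norm (G x)) \<le> V"
    and \<theta>: "0 \<le> \<theta>" "\<theta> \<le> 1" and r: "r > 0"
    and h: "integrable lborel (\<lambda>s. std_normal_density s * h s)"
    and hb: "\<And>s. s \<noteq> 0 \<Longrightarrow> (\<Prod>i\<in>UNIV. norm (osc_exponent e r s i) powr (-1/2)) powr \<theta> \<le> h s"
  shows "(LINT \<xi>|lborel. exp (- (r * norm (q_symbol e 1 \<xi>))\<^sup>2) * (exp (- (norm \<xi>)\<^sup>2) * (norm (fourier G \<xi>))\<^sup>2))
    \<le> V powr (1 + \<theta>) * (LINT s|lborel. std_normal_density s * h s)"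
proof -
  let ?F = "\<lambda>\<xi>. (norm (fourier G \<xi>))\<^sup>2" and ?D = "std_normal_density"
  have Fi: "integrable lborel (\<lambda>\<xi>. exp (- (norm \<xi>)\<^sup>2) * ?F \<xi>)"
    by (rule fourier_sq_gaussian_integrable)
  \<comment> \<open>Integrating over \<open>s\<close> first gives the weight \<open>exp (-r\<^sup>2|q|\<^sup>2) exp (-|\<xi>|\<^sup>2)\<close>; integrating over \<open>\<xi>\<close> first gives Gaussian energies.\<close>
  define \<Phi> where "\<Phi> = (\<lambda>(s, \<xi>). of_real (?D s) * (exp (\<i> * of_real (sqrt 2 * r * ((norm \<xi>)\<^sup>2 - 1) * s))
      * of_real (exp (- 4 * r\<^sup>2 * (\<xi> $ e)\<^sup>2 - (norm \<xi>)\<^sup>2)) * complex_of_real (?F \<xi>)))"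
  have \<Phi>m: "\<Phi> \<in> borel_measurable (lborel \<Otimes>\<^sub>M lborel)" unfolding \<Phi>_def by measurable
  have \<Phi>i: "integrable (lborel \<Otimes>\<^sub>M lborel) \<Phi>"
  proof (rule lborel_pair.integrable_dominated_by_product[OF _ Fi \<Phi>m])
    show "integrable lborel ?D" by simp
    fix s \<xi>
    have "exp (- 4 * r\<^sup>2 * (\<xi> $ e)\<^sup>2 - (norm \<xi>)\<^sup>2) \<le> exp (- (norm \<xi>)\<^sup>2)" by simp
    then show "norm (\<Phi> (s, \<xi>)) \<le> ?D s * (exp (- (norm \<xi>)\<^sup>2) * ?F \<xi>)"
      by (simp add: \<Phi>_def norm_mult norm_power mult_left_mono mult_right_mono del: exp_le_cancel_iff)
  qed
  have inner: "(LINT s|lborel. \<Phi> (s, \<xi>)) = of_real (exp (- (r * norm (q_symbol e 1 \<xi>))\<^sup>2) * (exp (- (norm \<xi>)\<^sup>2) * ?F \<xi>))" for \<xi>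
  proof -
    have "(LINT s|lborel. \<Phi> (s, \<xi>)) = (LINT s|lborel. (of_real (?D s) * exp (\<i> * of_real ((sqrt 2 * r * ((norm \<xi>)\<^sup>2 - 1)) * s)))
       * of_real (exp (- 4 * r\<^sup>2 * (\<xi> $ e)\<^sup>2 - (norm \<xi>)\<^sup>2) * ?F \<xi>))"
      by (simp add: \<Phi>_def mult.assoc)
    also have "\<dots> = of_real (exp (- (sqrt 2 * r * ((norm \<xi>)\<^sup>2 - 1))\<^sup>2 / 2)) * of_real (exp (- 4 * r\<^sup>2 * (\<xi> $ e)\<^sup>2 - (norm \<xi>)\<^sup>2) * ?F \<xi>)"
      unfolding integral_mult_left_zero char_std_normal_lborel ..
    also have "\<dots> = of_real ((exp (- (sqrt 2 * r * ((norm \<xi>)\<^sup>2 - 1))\<^sup>2 / 2) * exp (- 4 * r\<^sup>2 * (\<xi> $ e)\<^sup>2 - (norm \<xi>)\<^sup>2)) * ?F \<xi>)"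
      by simp
    also have "exp (- (sqrt 2 * r * ((norm \<xi>)\<^sup>2 - 1))\<^sup>2 / 2) * exp (- 4 * r\<^sup>2 * (\<xi> $ e)\<^sup>2 - (norm \<xi>)\<^sup>2)
        = exp (- (r * norm (q_symbol e 1 \<xi>))\<^sup>2) * exp (- (norm \<xi>)\<^sup>2)"
      unfolding exp_add[symmetric] power_mult_distrib norm_q_symbol_square
      by (intro arg_cong[where f = exp]) (simp add: algebra_simps)
    finally show ?thesis by (simp add: mult.assoc)
  qed
  define I where "I s = norm (LINT \<xi>|lborel. gauss_weight (osc_exponent e r s) \<xi> * of_real (?F \<xi>))" for s
  have outer: "norm (LINT \<xi>|lborel. \<Phi> (s, \<xi>)) = ?D s * I s" for s
  proof -
    have "(LINT \<xi>|lborel. \<Phi> (s, \<xi>)) = (LINT \<xi>|lborel. (of_real (?D s) * exp (- \<i> * of_real (sqrt 2 * r * s)))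
         * (gauss_weight (osc_exponent e r s) \<xi> * of_real (?F \<xi>)))"
      unfolding \<Phi>_def prod.case gauss_weight_osc[symmetric] by (simp only: mult.assoc)
    then show ?thesis by (simp only: integral_mult_right_zero norm_mult I_def norm_exp_minus_i norm_of_real) simp
  qed
  have Ib: "I s \<le> V powr (1 + \<theta>) * h s" if s: "s \<noteq> 0" for s
  proof -
    let ?b = "\<Prod>i\<in>UNIV. norm (osc_exponent e r s i) powr (-1/2)"
    have z: "Re (osc_exponent e r s i) \<ge> 1" for i by (simp add: osc_exponent_def)
    have "I s \<le> ?b powr \<theta> * V powr (1 + \<theta>)"
    proof (rule powr_interpolation[OF _ _ _ _ \<theta>])
      show "I s \<le> ?b * V\<^sup>2" unfolding I_def by (rule gauss_energy_dispersive[OF z G V])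
      have "I s \<le> (LINT \<xi>|lborel. norm (gauss_weight (osc_exponent e r s) \<xi> * of_real (?F \<xi>)))"
        unfolding I_def by (rule integral_norm_bound)
      also have "\<dots> \<le> (LINT \<xi>|lborel. exp (- (norm \<xi>)\<^sup>2) * ?F \<xi>)"
      proof (rule integral_mono'[OF Fi])
        fix \<xi>
        have "norm (gauss_weight (osc_exponent e r s) \<xi>) = norm (exp (- \<i> * of_real (sqrt 2 * r * s)) * gauss_weight (osc_exponent e r s) \<xi>)"
          by (simp add: norm_mult del: of_real_mult)
        also have "\<dots> \<le> exp (- (norm \<xi>)\<^sup>2)" unfolding gauss_weight_osc by (simp add: norm_mult del: of_real_mult)
        finally show "norm (gauss_weight (osc_exponent e r s) \<xi> * of_real (?F \<xi>)) \<le> exp (- (norm \<xi>)\<^sup>2) * ?F \<xi>"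
          by (simp add: norm_mult norm_power mult_right_mono)
      qed simp
      also have "\<dots> \<le> V" by (rule gauss_energy_plancherel[OF G G1 V])
      finally show "I s \<le> V" .
    qed (auto simp: I_def intro!: prod_nonneg)
    also have "\<dots> \<le> h s * V powr (1 + \<theta>)" by (intro mult_right_mono hb s) simp
    finally show ?thesis by (simp add: mult.commute)
  qed
  have "complex_of_real (LINT \<xi>|lborel. exp (- (r * norm (q_symbol e 1 \<xi>))\<^sup>2) * (exp (- (norm \<xi>)\<^sup>2) * ?F \<xi>))
     = (LINT \<xi>|lborel. LINT s|lborel. \<Phi> (s, \<xi>))"
    unfolding inner integral_complex_of_real ..
  also have "\<dots> = (LINT s|lborel. LINT \<xi>|lborel. \<Phi> (s, \<xi>))"
    using lborel_pair.Fubini_integral[of "\<lambda>s \<xi>. \<Phi> (s, \<xi>)"] \<Phi>i by simp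
  finally have "\<bar>LINT \<xi>|lborel. exp (- (r * norm (q_symbol e 1 \<xi>))\<^sup>2) * (exp (- (norm \<xi>)\<^sup>2) * ?F \<xi>)\<bar>
     = norm (LINT s|lborel. LINT \<xi>|lborel. \<Phi> (s, \<xi>))"
    unfolding norm_of_real[symmetric, where 'a=complex] by (rule arg_cong)
  also have "\<dots> \<le> (LINT s|lborel. ?D s * I s)"
    unfolding outer[symmetric] by (rule integral_norm_bound)
  also have "\<dots> \<le> (LINT s|lborel. V powr (1 + \<theta>) * (?D s * h s))"
  proof (rule integral_mono_AE)
    show "integrable lborel (\<lambda>s. ?D s * I s)"
      unfolding outer[symmetric] by (intro integrable_norm lborel_pair.integrable_fst' \<Phi>i)
    show "integrable lborel (\<lambda>s. V powr (1 + \<theta>) * (?D s * h s))" by (intro integrable_mult_right h)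
    show "AE s in lborel. ?D s * I s \<le> V powr (1 + \<theta>) * (?D s * h s)"
      using AE_lborel_singleton[of 0]
    proof eventually_elim
      fix s :: real assume "s \<noteq> 0"
      then show "?D s * I s \<le> V powr (1 + \<theta>) * (?D s * h s)"
        using mult_left_mono[OF Ib, of s "?D s"] by (simp add: mult.left_commute)
    qed
  qed
  finally show ?thesis by simp
qed

lemma osc_exponent_product_le_1:
  assumes "0 \<le> \<theta>"
  shows "(\<Prod>i\<in>UNIV. norm (osc_exponent (e::'n::finite) r s i) powr (-1/2)) powr \<theta> \<le> 1"
proof -
  have "norm (osc_exponent e r s i) powr (-1/2) \<le> 1" for i
  proof -
    have "1 \<le> norm (osc_exponent e r s i)"
      using complex_Re_le_cmod[of "osc_exponent e r s i"] by (auto simp: osc_exponent_def split: if_splits intro: order_trans[rotated])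
    then have "norm (osc_exponent e r s i) powr (-1/2) \<le> norm (osc_exponent e r s i) powr 0"
      by (intro powr_mono) auto
    also have "\<dots> \<le> 1" by simp
    finally show ?thesis .
  qed
  then have "(\<Prod>i\<in>UNIV. norm (osc_exponent e r s i) powr (-1/2)) \<le> 1" by (intro prod_le_1) auto
  moreover have "0 \<le> (\<Prod>i\<in>UNIV. norm (osc_exponent e r s i) powr (-1/2))" by (intro prod_nonneg) auto
  ultimately show ?thesis using assms by (intro powr_le1) auto
qed

text \<open>For large \<open>r\<close> the oscillation gives \<open>|z\<^sub>i| \<ge> r|s|\<close> in all coordinates but \<open>e\<close>, while in the coordinate
\<open>e\<close> the damping gives \<open>r\<^sup>2\<close>. The latter is the gain from the second codimension of the
zero set of \<open>q\<close>.\<close>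

lemma osc_exponent_product_decay:
  fixes e :: "'n::finite"
  assumes \<theta>: "0 \<le> \<theta>" and A: "A = \<theta> * (real CARD('n) - 1) / 2" and r: "r > 0" and s: "s \<noteq> 0"
  shows "(\<Prod>i\<in>UNIV. norm (osc_exponent e r s i) powr (-1/2)) powr \<theta> \<le> \<bar>s\<bar> powr (- A) * r powr (- (A + \<theta>))"
proof -
  let ?f = "\<lambda>i. norm (osc_exponent e r s i) powr (-1/2)"
  have rs: "r * \<bar>s\<bar> > 0" using r s by simp
  have n: "real (CARD('n) - 1) = real CARD('n) - 1" by (simp add: of_nat_diff Suc_leI)
  have fe: "?f e \<le> r powr (-1)"
  proof -
    have "r\<^sup>2 \<le> Re (osc_exponent e r s e)" using r by (simp add: osc_exponent_def)
    also have "\<dots> \<le> norm (osc_exponent e r s e)" by (rule complex_Re_le_cmod)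
    finally have "?f e \<le> (r\<^sup>2) powr (-1/2)" using r by (intro powr_mono2') auto
    also have "\<dots> = r powr (-1)" using r by (simp add: powr_powr flip: powr_numeral)
    finally show ?thesis .
  qed
  have fi: "?f i \<le> (r * \<bar>s\<bar>) powr (-1/2)" for i
  proof -
    have "1 \<le> sqrt 2" by simp
    then have "1 * (r * \<bar>s\<bar>) \<le> sqrt 2 * (r * \<bar>s\<bar>)" using rs by (intro mult_right_mono) auto
    also have "\<dots> = \<bar>Im (osc_exponent e r s i)\<bar>" using r by (simp add: osc_exponent_def abs_mult)
    also have "\<dots> \<le> norm (osc_exponent e r s i)" by (rule abs_Im_le_cmod)
    finally show ?thesis using rs by (intro powr_mono2') auto
  qed
  have "prod ?f UNIV = ?f e * prod ?f (UNIV - {e})" by (rule prod.remove) auto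
  also have "\<dots> \<le> r powr (-1) * (\<Prod>i\<in>UNIV - {e}. (r * \<bar>s\<bar>) powr (-1/2))"
    by (intro mult_mono fe prod_mono conjI fi prod_nonneg) auto
  also have "(\<Prod>i\<in>UNIV - {e}. (r * \<bar>s\<bar>) powr (-1/2)) = (r * \<bar>s\<bar>) powr (-1/2 * (real CARD('n) - 1))"
  proof -
    have "(\<Prod>i\<in>UNIV - {e}. (r * \<bar>s\<bar>) powr (-1/2)) = ((r * \<bar>s\<bar>) powr (-1/2)) powr real (CARD('n) - 1)"
      using rs by (subst powr_realpow) (auto simp: card_Diff_singleton)
    then show ?thesis unfolding powr_powr n .
  qed
  finally have "(prod ?f UNIV) powr \<theta> \<le> (r powr (-1) * (r * \<bar>s\<bar>) powr (-1/2 * (real CARD('n) - 1))) powr \<theta>"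
    using \<theta> by (intro powr_mono2 prod_nonneg) auto
  also have "\<dots> = r powr (- \<theta>) * (r * \<bar>s\<bar>) powr (- A)"
  proof -
    have "((r * \<bar>s\<bar>) powr (-1/2 * (real CARD('n) - 1))) powr \<theta> = (r * \<bar>s\<bar>) powr (- A)"
      unfolding powr_powr by (rule arg_cong[where f = "\<lambda>a. _ powr a"]) (simp add: A mult_ac)
    moreover have "(r powr (-1)) powr \<theta> = r powr (- \<theta>)"
      unfolding powr_powr by simp
    ultimately show ?thesis by (subst powr_mult) simp_all
  qed
  also have "\<dots> = \<bar>s\<bar> powr (- A) * r powr (- (A + \<theta>))"
    using r s by (simp add: powr_mult powr_add[symmetric] powr_diff[symmetric] mult_ac add_ac)
  finally show ?thesis .
qed

text \<open>The integral equals a constant times \<open>1/Q\<close>. For the lower bound it suffices that the integrand is at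
least \<open>1/e\<close> for \<open>r \<le> 1/Q\<close>. At \<open>Q = 0\<close> the left-hand side is 0 by the convention for division.\<close>

lemma inverse_le_gaussian_integral:
  fixes Q :: real
  assumes "Q \<ge> 0"
  shows "ennreal (1 / Q) \<le> ennreal (exp 1) * (\<integral>\<^sup>+r. indicator {0<..} r * ennreal (exp (- (r * Q)\<^sup>2)) \<partial>lborel)"
proof (cases "Q = 0")
  case False
  then have Q: "Q > 0" using assms by simp
  have "ennreal (1 / Q) = ennreal (exp 1) * (\<integral>\<^sup>+r. ennreal (exp (- 1)) * indicator {0<..1 / Q} r \<partial>lborel)"
    using Q by (simp add: nn_integral_cmult mult.assoc[symmetric] exp_minus flip: ennreal_mult)
  also have "\<dots> \<le> ennreal (exp 1) * (\<integral>\<^sup>+r. indicator {0<..} r * ennreal (exp (- (r * Q)\<^sup>2)) \<partial>lborel)"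
  proof (intro mult_left_mono nn_integral_mono)
    fix r :: real
    have "exp (- 1) \<le> exp (- (r * Q)\<^sup>2)" if "0 < r" "r \<le> 1 / Q"
    proof -
      have "r * Q \<le> 1" "0 \<le> r * Q" using that Q by (auto simp: field_simps)
      then have "(r * Q)\<^sup>2 \<le> 1" by (simp add: power_le_one)
      then show ?thesis by simp
    qed
    then show "ennreal (exp (- 1)) * indicator {0<..1 / Q} r \<le> indicator {0<..} r * ennreal (exp (- (r * Q)\<^sup>2))"
      by (auto simp: indicator_def intro!: ennreal_leI simp del: exp_le_cancel_iff)
  qed simp
  finally show ?thesis .
qed simp

text \<open>In applications \<open>G\<close> is a unimodular function restricted to a set of measure \<open>V\<close>, which makes both its
supremum and its \<open>L\<^sup>1\<close> norm available.\<close>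

definition singular_energy_bound :: "'n::finite \<Rightarrow> real \<Rightarrow> real \<Rightarrow> bool" where
  "singular_energy_bound e \<theta> C \<longleftrightarrow> (\<forall>(G :: real^'n \<Rightarrow> complex) V.
     integrable lborel G \<longrightarrow> (\<forall>x. norm (G x) \<le> 1) \<longrightarrow> (LINT x|lborel. norm (G x)) \<le> V \<longrightarrow>
     (\<integral>\<^sup>+\<xi>. ennreal (exp (- (norm \<xi>)\<^sup>2) * (norm (fourier G \<xi>))\<^sup>2 / norm (q_symbol e 1 \<xi>)) \<partial>lborel)
       \<le> ennreal (C * V powr (1 + \<theta>)))"

lemma singular_energy_bound_mono:
  assumes b: "singular_energy_bound e \<theta> C" and le: "C \<le> C'"
  shows "singular_energy_bound e \<theta> C'"
proof -
  have "ennreal (C * V powr (1 + \<theta>)) \<le> ennreal (C' * V powr (1 + \<theta>))" for V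
    using le by (intro ennreal_leI mult_right_mono) auto
  with b show ?thesis unfolding singular_energy_bound_def by (meson order_trans)
qed

text \<open>The integral over \<open>r\<close> of the averaged Gaussian energies. For \<open>r \<le> 1\<close> the dispersive factor is bounded
by 1, for \<open>r \<ge> 1\<close> it contributes \<open>r\<^bsup>-(A+\<theta>)\<^esup>\<close>, which is integrable exactly when \<open>A + \<theta> > 1\<close>; the
condition \<open>A < 1\<close> makes the constant \<open>K\<close>, the moment of order \<open>-A\<close> of the normal distribution, finite.\<close>

lemma energy_with_singular_weight:
  fixes e :: "'n::finite"
  assumes \<theta>: "0 \<le> \<theta>" "\<theta> \<le> 1" and A: "A = \<theta> * (real CARD('n) - 1) / 2" "A < 1" "A + \<theta> > 1"
  obtains C :: real where "C > 0"
    and "singular_energy_bound e \<theta> C"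
proof
  let ?D = std_normal_density
  define K where "K = (LINT s|lborel. ?D s * \<bar>s\<bar> powr (- A))"
  have A0: "0 \<le> A" using \<theta> by (simp add: A(1) Suc_leI)
  have K: "K \<ge> 0" unfolding K_def by (intro integral_nonneg_AE) auto
  define C where "C = exp 1 * (1 + K * (1 / (A + \<theta> - 1)))"
  show "C > 0" using K A by (auto simp: C_def intro!: mult_pos_pos add_pos_nonneg)
  show "singular_energy_bound e \<theta> C"
    unfolding singular_energy_bound_def
  proof (intro allI impI)
    fix G :: "real^'n \<Rightarrow> complex" and V
    assume G: "integrable lborel G" and "\<forall>x. norm (G x) \<le> 1" and V: "(LINT x|lborel. norm (G x)) \<le> V"
    then have G1: "norm (G x) \<le> 1" for x by blast
    let ?w = "\<lambda>\<xi>. exp (- (norm \<xi>)\<^sup>2) * (norm (fourier G \<xi>))\<^sup>2" and ?Q = "\<lambda>\<xi>::real^'n. norm (q_symbol e 1 \<xi>)"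
    define J where "J r = (LINT \<xi>|lborel. exp (- (r * ?Q \<xi>)\<^sup>2) * ?w \<xi>)" for r
    have wi: "integrable lborel ?w"
      by (rule fourier_sq_gaussian_integrable)
    have J1: "J r \<le> V powr (1 + \<theta>) * 1" if "r > 0" for r
      using averaged_gauss_energy[OF G G1 V \<theta> that, of "\<lambda>_. 1" e, OF _ osc_exponent_product_le_1[OF \<theta>(1)]]
        integral_normal_density[of 1 0] integrable_normal_density[of 1 0]
      by (simp add: J_def)
    have J2: "J r \<le> V powr (1 + \<theta>) * (K * r powr (- (A + \<theta>)))" if "r > 0" for r
    proof -
      have "integrable lborel (\<lambda>s. (?D s * \<bar>s\<bar> powr (- A)) * r powr (- (A + \<theta>)))"
        using integrable_std_normal_neg_powr[OF A0 A(2)] by (rule integrable_mult_left)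
      then have i: "integrable lborel (\<lambda>s. ?D s * (\<bar>s\<bar> powr (- A) * r powr (- (A + \<theta>))))"
        by (simp only: mult.assoc)
      have "J r \<le> V powr (1 + \<theta>) * (LINT s|lborel. ?D s * (\<bar>s\<bar> powr (- A) * r powr (- (A + \<theta>))))"
        unfolding J_def
        by (rule averaged_gauss_energy[OF G G1 V \<theta> that i osc_exponent_product_decay[OF \<theta>(1) A(1) that]])
      also have "(LINT s|lborel. ?D s * (\<bar>s\<bar> powr (- A) * r powr (- (A + \<theta>)))) = K * r powr (- (A + \<theta>))"
        unfolding mult.assoc[symmetric] integral_mult_left_zero K_def ..
      finally show ?thesis .
    qed
    have "(\<integral>\<^sup>+\<xi>. ennreal (?w \<xi> / ?Q \<xi>) \<partial>lborel)
        \<le> (\<integral>\<^sup>+\<xi>. ennreal (exp 1) * (\<integral>\<^sup>+r. indicator {0<..} r * ennreal (exp (- (r * ?Q \<xi>)\<^sup>2) * ?w \<xi>) \<partial>lborel) \<partial>lborel)"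
    proof (rule nn_integral_mono)
      fix \<xi>
      have "ennreal (?w \<xi> / ?Q \<xi>) = ennreal (1 / ?Q \<xi>) * ennreal (?w \<xi>)"
        by (subst ennreal_mult[symmetric]) auto
      also have "\<dots> \<le> (ennreal (exp 1) * (\<integral>\<^sup>+r. indicator {0<..} r * ennreal (exp (- (r * ?Q \<xi>)\<^sup>2)) \<partial>lborel)) * ennreal (?w \<xi>)"
        by (intro mult_right_mono inverse_le_gaussian_integral) auto
      also have "\<dots> = ennreal (exp 1) * (\<integral>\<^sup>+r. indicator {0<..} r * ennreal (exp (- (r * ?Q \<xi>)\<^sup>2)) * ennreal (?w \<xi>) \<partial>lborel)"
        by (subst nn_integral_multc) (auto simp: mult.assoc)
      finally show "ennreal (?w \<xi> / ?Q \<xi>) \<le> ennreal (exp 1) * (\<integral>\<^sup>+r. indicator {0<..} r * ennreal (exp (- (r * ?Q \<xi>)\<^sup>2) * ?w \<xi>) \<partial>lborel)"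
        by (simp add: ennreal_mult mult.assoc)
    qed
    also have "\<dots> = ennreal (exp 1) * (\<integral>\<^sup>+\<xi>. (\<integral>\<^sup>+r. indicator {0<..} r * ennreal (exp (- (r * ?Q \<xi>)\<^sup>2) * ?w \<xi>) \<partial>lborel) \<partial>lborel)"
      by (rule nn_integral_cmult) measurable
    also have "(\<integral>\<^sup>+\<xi>. (\<integral>\<^sup>+r. indicator {0<..} r * ennreal (exp (- (r * ?Q \<xi>)\<^sup>2) * ?w \<xi>) \<partial>lborel) \<partial>lborel)
       = (\<integral>\<^sup>+r. (\<integral>\<^sup>+\<xi>. indicator {0<..} r * ennreal (exp (- (r * ?Q \<xi>)\<^sup>2) * ?w \<xi>) \<partial>lborel) \<partial>lborel)"
      by (rule lborel_pair.Fubini') measurable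
    also have "\<dots> = (\<integral>\<^sup>+r. indicator {0<..} r * ennreal (J r) \<partial>lborel)"
    proof (rule nn_integral_cong)
      fix r
      have "integrable lborel (\<lambda>\<xi>. exp (- (r * ?Q \<xi>)\<^sup>2) * ?w \<xi>)"
      proof (rule Bochner_Integration.integrable_bound[OF wi])
        have "exp (- (r * ?Q \<xi>)\<^sup>2) * ?w \<xi> \<le> ?w \<xi>" for \<xi>
          by (intro mult_left_le_one_le) auto
        then show "AE \<xi> in lborel. norm (exp (- (r * ?Q \<xi>)\<^sup>2) * ?w \<xi>) \<le> norm (?w \<xi>)" by (intro AE_I2) auto
      qed measurable
      then have "(\<integral>\<^sup>+\<xi>. ennreal (exp (- (r * ?Q \<xi>)\<^sup>2) * ?w \<xi>) \<partial>lborel) = ennreal (J r)"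
        unfolding J_def by (rule nn_integral_eq_integral) auto
      then show "(\<integral>\<^sup>+\<xi>. indicator {0<..} r * ennreal (exp (- (r * ?Q \<xi>)\<^sup>2) * ?w \<xi>) \<partial>lborel) = indicator {0<..} r * ennreal (J r)"
        by (subst nn_integral_cmult) auto
    qed
    also have "\<dots> \<le> (\<integral>\<^sup>+r. ennreal (V powr (1 + \<theta>)) * (indicator {0<..1} r + ennreal K * (ennreal (r powr (- (A + \<theta>))) * indicator {1..} r)) \<partial>lborel)"
    proof (rule nn_integral_mono)
      fix r :: real
      consider "r \<le> 0" | "0 < r" "r \<le> 1" | "1 < r" by linarith
      then show "indicator {0<..} r * ennreal (J r) \<le> ennreal (V powr (1 + \<theta>)) * (indicator {0<..1} r + ennreal K * (ennreal (r powr (- (A + \<theta>))) * indicator {1..} r))"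
      proof cases
        case 2
        have "ennreal (J r) \<le> ennreal (V powr (1 + \<theta>)) * 1" using J1[OF 2(1)] by (simp add: ennreal_leI)
        also have "\<dots> \<le> ennreal (V powr (1 + \<theta>)) * (1 + ennreal K * (ennreal (r powr (- (A + \<theta>))) * indicator {1..} r))"
          by (intro mult_left_mono) auto
        finally show ?thesis using 2 by simp
      next
        case 3
        then show ?thesis using J2[of r] K by (simp add: ennreal_leI flip: ennreal_mult)
      qed simp
    qed
    also have "\<dots> = ennreal (V powr (1 + \<theta>)) * (1 + ennreal K * (\<integral>\<^sup>+r. ennreal (r powr (- (A + \<theta>))) * indicator {1..} r \<partial>lborel))"
      by (simp add: nn_integral_cmult nn_integral_add)
    also have "(\<integral>\<^sup>+r. ennreal (r powr (- (A + \<theta>))) * indicator {1..} r \<partial>lborel) = ennreal (1 / (A + \<theta> - 1))"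
    proof -
      have "((\<lambda>r. r powr (- (A + \<theta>))) has_integral - (1 powr (- (A + \<theta>) + 1)) / (- (A + \<theta>) + 1)) {1..}"
        using A by (intro has_integral_powr_to_inf) auto
      also have "- (1 powr (- (A + \<theta>) + 1)) / (- (A + \<theta>) + 1) = 1 / (A + \<theta> - 1)"
        using A by (simp add: field_simps)
      finally show ?thesis by (intro nn_integral_has_integral_lebesgue') auto
    qed
    also have "ennreal (exp 1) * (ennreal (V powr (1 + \<theta>)) * (1 + ennreal K * ennreal (1 / (A + \<theta> - 1)))) = ennreal (C * V powr (1 + \<theta>))"
    proof -
      define X where "X = 1 + K * (1 / (A + \<theta> - 1))"
      have X: "X \<ge> 0" using K A(3) by (simp add: X_def)
      have eq: "1 + ennreal K * ennreal (1 / (A + \<theta> - 1)) = ennreal X" unfolding X_def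
        using K A(3) by (subst ennreal_mult[symmetric]) (auto simp: ennreal_1[symmetric] simp del: ennreal_1)
      show ?thesis unfolding eq C_def X_def[symmetric] using X by (simp add: ennreal_mult[symmetric] mult_ac)
    qed
    finally show "(\<integral>\<^sup>+\<xi>. ennreal (?w \<xi> / ?Q \<xi>) \<partial>lborel) \<le> ennreal (C * V powr (1 + \<theta>))"
      by (simp add: mult_left_mono)
  qed
qed

section \<open>From level sets to the Lebesgue norm\<close>

lemma epowr_mono: "x \<le> ennreal y \<Longrightarrow> 0 \<le> y \<Longrightarrow> 0 \<le> a \<Longrightarrow> epowr x a \<le> ennreal (y powr a)"
  unfolding epowr_def using enn2real_leI[of y x]
  by (auto intro!: ennreal_leI powr_mono2 simp: top_unique)

lemma epowr_le: "x \<le> y \<Longrightarrow> 0 \<le> a \<Longrightarrow> epowr x a \<le> epowr y a"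
  unfolding epowr_def by (auto intro!: ennreal_leI powr_mono2 enn2real_mono simp: less_top top_unique)

lemma epowr_cmult: "c > 0 \<Longrightarrow> epowr (ennreal c * x) a = ennreal (c powr a) * epowr x a"
  by (cases x) (auto simp: epowr_def ennreal_mult_top powr_mult simp flip: ennreal_mult)

lemma epowr_half_square: "(epowr x (1 / 2))\<^sup>2 = x"
  by (cases x) (auto simp: epowr_def ennreal_power powr_half_sqrt)

text \<open>Integrate \<open>p \<alpha>\<^bsup>p-1\<^esup>\<close> against the measures of the level sets, with the weak bound of exponent \<open>p0\<close> for
\<open>\<alpha> \<le> a\<close> and the one of exponent \<open>p1\<close> for \<open>\<alpha> \<ge> a\<close>. For \<open>a = 0\<close> all level sets are null, which has to be
separated since \<open>\<alpha>\<^bsup>p-1-p1\<^esup>\<close> is not integrable at 0.\<close>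

lemma layer_cake_interpolation:
  fixes v :: "'a::euclidean_space \<Rightarrow> real"
  assumes [measurable]: "v \<in> borel_measurable borel" and v0: "\<And>x. v x \<ge> 0"
    and p: "0 < p0" "p0 < p" "p < p1" and a: "a \<ge> 0"
    and w0: "\<And>\<alpha>. \<alpha> > 0 \<Longrightarrow> emeasure lborel {x. \<alpha> \<le> v x} \<le> ennreal ((a / \<alpha>) powr p0)"
    and w1: "\<And>\<alpha>. \<alpha> > 0 \<Longrightarrow> emeasure lborel {x. \<alpha> \<le> v x} \<le> ennreal ((a / \<alpha>) powr p1)"
  shows "(\<integral>\<^sup>+x. ennreal (v x powr p) \<partial>lborel) \<le> ennreal (p * (1 / (p - p0) + 1 / (p1 - p)) * a powr p)"
proof -
  have vp: "ennreal (v x powr p) = ennreal p * (\<integral>\<^sup>+\<alpha>. (if 0 \<le> \<alpha> \<and> \<alpha> \<le> v x then ennreal (\<alpha> powr (p - 1)) else 0) \<partial>lborel)" for x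
  proof -
    have "((\<lambda>\<alpha>. \<alpha> powr (p - 1)) has_integral (v x powr (p - 1 + 1) / (p - 1 + 1))) {0..v x}"
      using p v0 by (intro has_integral_powr_from_0) auto
    then have "(\<integral>\<^sup>+\<alpha>. ennreal (\<alpha> powr (p - 1)) * indicator {0..v x} \<alpha> \<partial>lborel) = ennreal (v x powr p / p)"
      by (intro nn_integral_has_integral_lebesgue') auto
    also have "(\<lambda>\<alpha>. ennreal (\<alpha> powr (p - 1)) * indicator {0..v x} \<alpha>) = (\<lambda>\<alpha>. if 0 \<le> \<alpha> \<and> \<alpha> \<le> v x then ennreal (\<alpha> powr (p - 1)) else 0)"
      by (auto simp: fun_eq_iff indicator_def)
    finally show ?thesis using p by (simp flip: ennreal_mult)
  qed
  have outer: "(\<integral>\<^sup>+x. ennreal (v x powr p) \<partial>lborel) =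
      ennreal p * (\<integral>\<^sup>+x. (\<integral>\<^sup>+\<alpha>. (if 0 \<le> \<alpha> \<and> \<alpha> \<le> v x then ennreal (\<alpha> powr (p - 1)) else 0) \<partial>lborel) \<partial>lborel)"
    unfolding vp by (rule nn_integral_cmult) measurable
  have "(\<integral>\<^sup>+x. (\<integral>\<^sup>+\<alpha>. (if 0 \<le> \<alpha> \<and> \<alpha> \<le> v x then ennreal (\<alpha> powr (p - 1)) else 0) \<partial>lborel) \<partial>lborel)
      = (\<integral>\<^sup>+\<alpha>. (\<integral>\<^sup>+x. (if 0 \<le> \<alpha> \<and> \<alpha> \<le> v x then ennreal (\<alpha> powr (p - 1)) else 0) \<partial>lborel) \<partial>lborel)"
    by (rule lborel_pair.Fubini') measurable
  also have "\<dots> \<le> (\<integral>\<^sup>+\<alpha>. ennreal (a powr p0) * (ennreal (\<alpha> powr (p - 1 - p0)) * indicator {0..a} \<alpha>)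
       + ennreal (a powr p1) * (ennreal (\<alpha> powr (p - 1 - p1)) * (if a = 0 then 0 else indicator {a..} \<alpha>)) \<partial>lborel)"
  proof (rule nn_integral_mono)
    fix \<alpha> :: real
    have *: "(\<integral>\<^sup>+x. (if 0 \<le> \<alpha> \<and> \<alpha> \<le> v x then ennreal (\<alpha> powr (p - 1)) else 0) \<partial>lborel) = ennreal (\<alpha> powr (p - 1)) * emeasure lborel {x. \<alpha> \<le> v x}"
      if "\<alpha> > 0"
    proof -
      have "(\<lambda>x. if 0 \<le> \<alpha> \<and> \<alpha> \<le> v x then ennreal (\<alpha> powr (p - 1)) else 0) = (\<lambda>x. ennreal (\<alpha> powr (p - 1)) * indicator {x. \<alpha> \<le> v x} x)"
        using that by (auto simp: fun_eq_iff indicator_def)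
      then show ?thesis by (simp add: nn_integral_cmult_indicator)
    qed
    have **: "ennreal (\<alpha> powr (p - 1)) * ennreal ((a / \<alpha>) powr q) = ennreal (a powr q) * ennreal (\<alpha> powr (p - 1 - q))" if "\<alpha> > 0" for q
      using that a by (subst (1 2) ennreal_mult[symmetric]) (auto simp: powr_divide powr_diff)
    consider "\<alpha> \<le> 0" | "\<alpha> > 0" "a = 0" | "\<alpha> > 0" "\<alpha> \<le> a" | "\<alpha> > 0" "a > 0" "a < \<alpha>" using a by linarith
    then show "(\<integral>\<^sup>+x. (if 0 \<le> \<alpha> \<and> \<alpha> \<le> v x then ennreal (\<alpha> powr (p - 1)) else 0) \<partial>lborel)
      \<le> ennreal (a powr p0) * (ennreal (\<alpha> powr (p - 1 - p0)) * indicator {0..a} \<alpha>)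
       + ennreal (a powr p1) * (ennreal (\<alpha> powr (p - 1 - p1)) * (if a = 0 then 0 else indicator {a..} \<alpha>))"
    proof cases
      case 1
      then have "(\<lambda>x. if 0 \<le> \<alpha> \<and> \<alpha> \<le> v x then ennreal (\<alpha> powr (p - 1)) else 0) = (\<lambda>_. 0)"
        by (auto simp: fun_eq_iff)
      then show ?thesis by (simp only: nn_integral_const) simp
    next
      case 2
      then show ?thesis unfolding *[OF 2(1)] using w0[OF 2(1)] by simp
    next
      case 3
      have "ennreal (\<alpha> powr (p - 1)) * emeasure lborel {x. \<alpha> \<le> v x} \<le> ennreal (a powr p0) * ennreal (\<alpha> powr (p - 1 - p0))"
        unfolding **[OF 3(1), symmetric] by (intro mult_left_mono w0 3) simp
      then show ?thesis unfolding *[OF 3(1)] using 3 by (auto intro: order_trans)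
    next
      case 4
      have "ennreal (\<alpha> powr (p - 1)) * emeasure lborel {x. \<alpha> \<le> v x} \<le> ennreal (a powr p1) * ennreal (\<alpha> powr (p - 1 - p1))"
        unfolding **[OF 4(1), symmetric] by (intro mult_left_mono w1 4) simp
      then show ?thesis unfolding *[OF 4(1)] using 4 by simp
    qed
  qed
  also have "\<dots> = ennreal (a powr p0) * (\<integral>\<^sup>+\<alpha>. ennreal (\<alpha> powr (p - 1 - p0)) * indicator {0..a} \<alpha> \<partial>lborel)
      + ennreal (a powr p1) * (\<integral>\<^sup>+\<alpha>. ennreal (\<alpha> powr (p - 1 - p1)) * (if a = 0 then 0 else indicator {a..} \<alpha>) \<partial>lborel)"
    by (simp add: nn_integral_add nn_integral_cmult)
  also have "(\<integral>\<^sup>+\<alpha>. ennreal (\<alpha> powr (p - 1 - p0)) * indicator {0..a} \<alpha> \<partial>lborel) = ennreal (a powr (p - p0) / (p - p0))"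
  proof -
    have "((\<lambda>\<alpha>. \<alpha> powr (p - 1 - p0)) has_integral (a powr (p - 1 - p0 + 1) / (p - 1 - p0 + 1))) {0..a}"
      using p a by (intro has_integral_powr_from_0) auto
    also have "p - 1 - p0 + 1 = p - p0" by simp
    finally show ?thesis by (intro nn_integral_has_integral_lebesgue') auto
  qed
  also have "(\<integral>\<^sup>+\<alpha>. ennreal (\<alpha> powr (p - 1 - p1)) * (if a = 0 then 0 else indicator {a..} \<alpha>) \<partial>lborel) = ennreal (a powr (p - p1) / (p1 - p))"
  proof (cases "a = 0")
    case False
    have "((\<lambda>\<alpha>. \<alpha> powr (p - 1 - p1)) has_integral (- (a powr (p - 1 - p1 + 1)) / (p - 1 - p1 + 1))) {a..}"
      using p a False by (intro has_integral_powr_to_inf) auto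
    also have "- (a powr (p - 1 - p1 + 1)) / (p - 1 - p1 + 1) = a powr (p - p1) / (p1 - p)"
      using p by (simp add: minus_divide_right)
    finally have "(\<integral>\<^sup>+\<alpha>. ennreal (\<alpha> powr (p - 1 - p1)) * indicator {a..} \<alpha> \<partial>lborel) = ennreal (a powr (p - p1) / (p1 - p))"
      by (intro nn_integral_has_integral_lebesgue') auto
    then show ?thesis using False by simp
  qed simp
  also have "ennreal (a powr p0) * ennreal (a powr (p - p0) / (p - p0)) + ennreal (a powr p1) * ennreal (a powr (p - p1) / (p1 - p))
     = ennreal ((1 / (p - p0) + 1 / (p1 - p)) * a powr p)"
  proof -
    have "a powr q * a powr (p - q) = a powr p" for q by (simp flip: powr_add)
    then show ?thesis using p by (simp add: ennreal_mult[symmetric] ennreal_plus[symmetric] algebra_simps del: ennreal_plus)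
  qed
  finally show ?thesis
    unfolding outer using p by (simp add: ennreal_mult' mult.assoc mult_left_mono)
qed

lemma AE_q_symbol_nonzero: "AE \<xi> in lborel. q_symbol (e::'n::finite) 1 \<xi> \<noteq> 0"
proof -
  have "negligible {\<xi>::real^'n. \<xi> $ e = 0}" by (rule negligible_standard_hyperplane_cart)
  moreover have "{\<xi>::real^'n. \<xi> $ e = 0} \<in> sets lborel" by simp
  ultimately have "{\<xi>::real^'n. \<xi> $ e = 0} \<in> null_sets lborel"
    by (simp add: negligible_iff_null_sets null_sets_completion_iff)
  then show ?thesis
  proof (rule AE_I')
    show "{\<xi> \<in> space lborel. \<not> q_symbol e 1 \<xi> \<noteq> 0} \<subseteq> {\<xi>. \<xi> $ e = 0}"
    proof
      fix \<xi> assume "\<xi> \<in> {\<xi> \<in> space lborel. \<not> q_symbol e 1 \<xi> \<noteq> 0}"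
      then have "Im (q_symbol e 1 \<xi>) = 0" by simp
      then show "\<xi> \<in> {\<xi>. \<xi> $ e = 0}" by (simp add: q_symbol_def)
    qed
  qed
qed

lemma cnj_sgn_times: "cnj (sgn z) * z = of_real (norm z)"
proof (cases "z = 0")
  case False
  have "cnj (sgn z) * z = of_real ((norm z)\<^sup>2) / of_real (norm z)"
    unfolding complex_norm_square by (simp add: sgn_eq mult.commute)
  then show ?thesis using False by (simp add: power2_eq_square)
qed simp

text \<open>Duality on a set \<open>E\<close> where \<open>|\<F> g| \<ge> \<alpha>\<close>: pairing \<open>\<F> g\<close> with its conjugate phase on \<open>E\<close> gives at least
\<open>\<alpha>|E|\<close>. Moving the transform onto the phase and splitting the integrand as
\<open>(|q|\<^bsup>1/2\<^esup> |g|) (|q|\<^bsup>-1/2\<^esup> |\<F> H|)\<close>, Cauchy--Schwarz leaves the two energies. The support of \<open>g\<close> allows the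
weight \<open>exp (-|\<xi>|\<^sup>2)\<close> to be inserted at the price \<open>exp (R\<^sup>2)\<close>.\<close>

lemma level_set_energy:
  fixes g :: "real^'n::finite \<Rightarrow> complex" and e :: 'n
  assumes C: "singular_energy_bound e \<theta> C"
    and g: "integrable lborel g" and supp: "\<And>\<xi>. norm \<xi> > R \<Longrightarrow> g \<xi> = 0" and R: "R \<ge> 0"
    and [measurable]: "E \<in> sets borel" and Ef: "emeasure lborel E < \<infinity>"
    and Ea: "\<And>x. x \<in> E \<Longrightarrow> \<alpha> \<le> norm (fourier g x)" and \<alpha>: "\<alpha> > 0"
  shows "ennreal ((\<alpha> * measure lborel E)\<^sup>2)
    \<le> (\<integral>\<^sup>+\<xi>. ennreal (norm (q_symbol e 1 \<xi>) * (norm (g \<xi>))\<^sup>2) \<partial>lborel) * ennreal (exp (R\<^sup>2) * C * measure lborel E powr (1 + \<theta>))"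
proof -
  let ?Q = "\<lambda>\<xi>. norm (q_symbol e 1 \<xi>)"
  have [measurable]: "g \<in> borel_measurable borel" using g by simp
  have [measurable]: "cball (0 :: real^'n) R \<in> sets borel" by simp
  define H where "H x = indicator E x * cnj (sgn (fourier g x))" for x
  have Hm[measurable]: "H \<in> borel_measurable borel" unfolding H_def[abs_def] sgn_div_norm by measurable
  have Hle: "norm (H x) \<le> indicator E x" for x by (simp add: H_def norm_mult norm_sgn indicator_def)
  then have H1: "norm (H x) \<le> 1" for x by (rule order_trans) (simp add: indicator_def)
  note Hi = integrable_of_le_indicator[OF Hm _ Ef Hle, simplified]
  have "\<alpha> * measure lborel E = (LINT x|lborel. \<alpha> * indicator E x)" by simp
  also have "\<dots> \<le> (LINT x|lborel. norm (H x * fourier g x))"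
  proof (rule integral_mono)
    show "integrable lborel (\<lambda>x. \<alpha> * indicator E x)" using Ef by simp
    show "integrable lborel (\<lambda>x. norm (H x * fourier g x))" by (intro integrable_norm integrable_mult_fourier Hi)
    show "\<alpha> * indicator E x \<le> norm (H x * fourier g x)" for x
      using Ea[of x] \<alpha> by (auto simp: H_def norm_mult norm_sgn indicator_def)
  qed
  also have "\<dots> = Re (LINT x|lborel. H x * fourier g x)"
  proof -
    have "H x * fourier g x = of_real (norm (H x * fourier g x))" for x
      by (simp add: H_def cnj_sgn_times mult.assoc norm_mult indicator_def)
    then have "(LINT x|lborel. H x * fourier g x) = of_real (LINT x|lborel. norm (H x * fourier g x))"
      unfolding integral_complex_of_real[symmetric] by (rule Bochner_Integration.integral_cong[OF refl])
    then show ?thesis by simp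
  qed
  also have "(LINT x|lborel. H x * fourier g x) = (LINT \<xi>|lborel. fourier H \<xi> * g \<xi>)"
    by (rule fourier_multiplication_formula[OF Hi(1) g])
  also have "Re \<dots> \<le> norm \<dots>" by (rule complex_Re_le_cmod)
  finally have "ennreal (\<alpha> * measure lborel E) \<le> ennreal (norm (LINT \<xi>|lborel. fourier H \<xi> * g \<xi>))"
    by (rule ennreal_leI)
  also have "\<dots> \<le> (\<integral>\<^sup>+\<xi>. ennreal (norm (fourier H \<xi> * g \<xi>)) \<partial>lborel)"
    using integrable_mult_fourier[OF g, of H] by (intro integral_norm_bound_ennreal) (simp add: mult.commute)
  also have "\<dots> \<le> (\<integral>\<^sup>+\<xi>. ennreal (sqrt (?Q \<xi>) * norm (g \<xi>)) * ennreal (indicator (cball 0 R) \<xi> * norm (fourier H \<xi>) / sqrt (?Q \<xi>)) \<partial>lborel)"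
  proof (rule nn_integral_mono_AE)
    show "AE \<xi> in lborel. ennreal (norm (fourier H \<xi> * g \<xi>)) \<le> ennreal (sqrt (?Q \<xi>) * norm (g \<xi>)) * ennreal (indicator (cball 0 R) \<xi> * norm (fourier H \<xi>) / sqrt (?Q \<xi>))"
      using AE_q_symbol_nonzero[of e]
    proof eventually_elim
      fix \<xi> assume "q_symbol e 1 \<xi> \<noteq> 0"
      then have "norm (fourier H \<xi> * g \<xi>) = (sqrt (?Q \<xi>) * norm (g \<xi>)) * (indicator (cball 0 R) \<xi> * norm (fourier H \<xi>) / sqrt (?Q \<xi>))"
        using supp[of \<xi>] by (auto simp: norm_mult indicator_def)
      then show "ennreal (norm (fourier H \<xi> * g \<xi>)) \<le> ennreal (sqrt (?Q \<xi>) * norm (g \<xi>)) * ennreal (indicator (cball 0 R) \<xi> * norm (fourier H \<xi>) / sqrt (?Q \<xi>))"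
        by (simp flip: ennreal_mult)
    qed
  qed
  finally have "(ennreal (\<alpha> * measure lborel E))\<^sup>2 \<le> \<dots>\<^sup>2" by (rule power_mono) simp
  also have "\<dots> \<le> (\<integral>\<^sup>+\<xi>. (ennreal (sqrt (?Q \<xi>) * norm (g \<xi>)))\<^sup>2 \<partial>lborel)
      * (\<integral>\<^sup>+\<xi>. (ennreal (indicator (cball 0 R) \<xi> * norm (fourier H \<xi>) / sqrt (?Q \<xi>)))\<^sup>2 \<partial>lborel)"
    by (rule Cauchy_Schwarz_nn_integral) measurable
  also have "\<dots> \<le> (\<integral>\<^sup>+\<xi>. ennreal (?Q \<xi> * (norm (g \<xi>))\<^sup>2) \<partial>lborel)
      * (\<integral>\<^sup>+\<xi>. ennreal (exp (R\<^sup>2)) * ennreal (exp (- (norm \<xi>)\<^sup>2) * (norm (fourier H \<xi>))\<^sup>2 / ?Q \<xi>) \<partial>lborel)"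
  proof (intro mult_mono nn_integral_mono)
    fix \<xi>
    show "(ennreal (sqrt (?Q \<xi>) * norm (g \<xi>)))\<^sup>2 \<le> ennreal (?Q \<xi> * (norm (g \<xi>))\<^sup>2)"
      by (simp add: ennreal_power power_mult_distrib)
    have "(indicator (cball 0 R) \<xi> * norm (fourier H \<xi>) / sqrt (?Q \<xi>))\<^sup>2 = indicator (cball 0 R) \<xi> * ((norm (fourier H \<xi>))\<^sup>2 / ?Q \<xi>)"
      by (simp add: power_mult_distrib power_divide indicator_def)
    also have "\<dots> \<le> (exp (R\<^sup>2) * exp (- (norm \<xi>)\<^sup>2)) * ((norm (fourier H \<xi>))\<^sup>2 / ?Q \<xi>)"
    proof (rule mult_right_mono)
      show "indicator (cball 0 R) \<xi> \<le> exp (R\<^sup>2) * exp (- (norm \<xi>)\<^sup>2)"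
        using power_mono[of "norm \<xi>" R 2] by (auto simp: indicator_def simp flip: exp_add)
    qed simp
    finally show "(ennreal (indicator (cball 0 R) \<xi> * norm (fourier H \<xi>) / sqrt (?Q \<xi>)))\<^sup>2
       \<le> ennreal (exp (R\<^sup>2)) * ennreal (exp (- (norm \<xi>)\<^sup>2) * (norm (fourier H \<xi>))\<^sup>2 / ?Q \<xi>)"
      by (simp add: ennreal_power ennreal_leI mult.assoc flip: ennreal_mult)
  qed simp_all
  also have "(\<integral>\<^sup>+\<xi>. ennreal (exp (R\<^sup>2)) * ennreal (exp (- (norm \<xi>)\<^sup>2) * (norm (fourier H \<xi>))\<^sup>2 / ?Q \<xi>) \<partial>lborel)
      = ennreal (exp (R\<^sup>2)) * (\<integral>\<^sup>+\<xi>. ennreal (exp (- (norm \<xi>)\<^sup>2) * (norm (fourier H \<xi>))\<^sup>2 / ?Q \<xi>) \<partial>lborel)"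
    by (rule nn_integral_cmult) measurable
  also have "\<dots> \<le> ennreal (exp (R\<^sup>2)) * ennreal (C * measure lborel E powr (1 + \<theta>))"
    using C Hi H1 unfolding singular_energy_bound_def by (intro mult_left_mono) auto
  finally show ?thesis
    using \<alpha> by (simp add: ennreal_power ennreal_mult'[symmetric] mult.assoc mult_left_mono)
qed

text \<open>The previous inequality reads \<open>\<alpha>\<^sup>2V\<^sup>2 \<le> a\<^sup>2V\<^bsup>1+\<theta>\<^esup>\<close>; solving for \<open>V\<close> gives the weak-type bound. Since
one may divide by \<open>V\<close> only when it is finite, the level set is first intersected with balls.\<close>

lemma level_set_measure:
  fixes g :: "real^'n::finite \<Rightarrow> complex" and e :: 'n
  assumes C: "singular_energy_bound e \<theta> C"
    and C0: "C \<ge> 0" and \<theta>: "\<theta> < 1"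
    and g: "integrable lborel g" and supp: "\<And>\<xi>. norm \<xi> > R \<Longrightarrow> g \<xi> = 0" and R: "R \<ge> 0"
    and N: "(\<integral>\<^sup>+\<xi>. ennreal (norm (q_symbol e 1 \<xi>) * (norm (g \<xi>))\<^sup>2) \<partial>lborel) = ennreal N" "N \<ge> 0"
    and \<alpha>: "\<alpha> > 0"
  shows "emeasure lborel {x. \<alpha> \<le> norm (fourier g x)} \<le> ennreal ((sqrt (exp (R\<^sup>2) * C * N) / \<alpha>) powr (2 / (1 - \<theta>)))"
proof -
  define a where "a = sqrt (exp (R\<^sup>2) * C * N)"
  have a: "a \<ge> 0" "a\<^sup>2 = exp (R\<^sup>2) * C * N" using C0 N by (auto simp: a_def)
  define S where "S = {x. \<alpha> \<le> norm (fourier g x)}"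
  have S: "S \<in> sets borel" unfolding S_def by measurable
  define E where "E n = S \<inter> cball 0 (real n)" for n
  have Es: "E n \<in> sets borel" for n unfolding E_def using S by auto
  have Ef: "emeasure lborel (E n) < \<infinity>" for n
    by (rule le_less_trans[OF emeasure_mono emeasure_lborel_cball_finite[of 0 "real n"]]) (auto simp: E_def)
  have bound: "emeasure lborel (E n) \<le> ennreal ((a / \<alpha>) powr (2 / (1 - \<theta>)))" for n
  proof -
    define V where "V = measure lborel (E n)"
    have "ennreal ((\<alpha> * V)\<^sup>2) \<le> ennreal N * ennreal (exp (R\<^sup>2) * C * V powr (1 + \<theta>))"
      unfolding V_def N(1)[symmetric]
      by (rule level_set_energy[OF C g supp R Es Ef _ \<alpha>]) (auto simp: E_def S_def)
    then have le: "(\<alpha> * V)\<^sup>2 \<le> a\<^sup>2 * V powr (1 + \<theta>)"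
      using N(2) C0 a(2) by (simp add: ennreal_mult[symmetric] mult_ac)
    have "V \<le> (a / \<alpha>) powr (2 / (1 - \<theta>))"
    proof (cases "V = 0")
      case False
      then have V: "V > 0" by (simp add: V_def order_less_le)
      have "V powr (1 - \<theta>) * V powr (1 + \<theta>) = V\<^sup>2" using V by (simp flip: powr_add)
      then have "(\<alpha>\<^sup>2 * V powr (1 - \<theta>)) * V powr (1 + \<theta>) \<le> a\<^sup>2 * V powr (1 + \<theta>)"
        using le by (simp add: power_mult_distrib mult.assoc)
      then have "\<alpha>\<^sup>2 * V powr (1 - \<theta>) \<le> a\<^sup>2" using V by simp
      then have "V powr (1 - \<theta>) \<le> (a / \<alpha>)\<^sup>2"
        using \<alpha> by (simp add: power_divide field_simps)
      then have "(V powr (1 - \<theta>)) powr (1 / (1 - \<theta>)) \<le> ((a / \<alpha>)\<^sup>2) powr (1 / (1 - \<theta>))"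
        using \<theta> by (intro powr_mono2) auto
      also have "((a / \<alpha>)\<^sup>2) powr (1 / (1 - \<theta>)) = (a / \<alpha>) powr (2 / (1 - \<theta>))"
      proof (cases "a = 0")
        case False
        then have "(a / \<alpha>)\<^sup>2 = (a / \<alpha>) powr 2" using a \<alpha> by simp
        then show ?thesis by (simp only: powr_powr) simp
      qed simp
      finally show ?thesis using V \<theta> by (simp add: powr_powr)
    qed simp
    then show ?thesis using Ef[of n] by (simp add: emeasure_eq_ennreal_measure V_def ennreal_leI)
  qed
  have "(SUP n. emeasure lborel (E n)) = emeasure lborel (\<Union>n. E n)"
    using Es by (intro SUP_emeasure_incseq) (auto simp: E_def incseq_def)
  also have "(\<Union>n. E n) = S"
    unfolding E_def using real_arch_simple by fastforce
  finally have "emeasure lborel S = (SUP n. emeasure lborel (E n))" ..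
  also have "\<dots> \<le> ennreal ((a / \<alpha>) powr (2 / (1 - \<theta>)))" by (rule SUP_least) (rule bound)
  finally show ?thesis unfolding S_def a_def .
qed

text \<open>The Stein--Tomas type estimate at unit frequency, from weak-type bounds on both sides of \<open>p\<close>.\<close>

lemma extension_estimate_unit:
  fixes e :: "'n::finite"
  assumes n: "CARD('n) \<ge> 3" and R: "R \<ge> 0"
  shows "\<exists>C>0. \<forall>g :: real^'n \<Rightarrow> complex. integrable lborel g \<longrightarrow> (\<forall>\<xi>. norm \<xi> > R \<longrightarrow> g \<xi> = 0) \<longrightarrow>
    Lp_norm (p_exponent CARD('n)) (fourier g)
      \<le> ennreal C * epowr (\<integral>\<^sup>+\<xi>. ennreal (norm (q_symbol e 1 \<xi>) * (norm (g \<xi>))\<^sup>2) \<partial>lborel) (1 / 2)"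
proof -
  define d where "d = real CARD('n)"
  have d: "d \<ge> 3" using n by (simp add: d_def)
  \<comment> \<open>Any \<open>\<theta>0 < 2/d < \<theta>1\<close> in the interval \<open>(2/(d + 1), 2/(d - 1))\<close> would do; these move \<open>d\<close> by \<open>1/2\<close>.\<close>
  define \<theta>0 \<theta>1 where "\<theta>0 = 4 / (2 * d + 1)" and "\<theta>1 = 4 / (2 * d - 1)"
  define p p0 p1 where "p = p_exponent CARD('n)" and "p0 = 2 / (1 - \<theta>0)" and "p1 = 2 / (1 - \<theta>1)"
  have \<theta>: "0 \<le> \<theta>0" "\<theta>0 \<le> 1" "\<theta>0 < 1" "0 \<le> \<theta>1" "\<theta>1 \<le> 1" "\<theta>1 < 1"
    using d by (auto simp: \<theta>0_def \<theta>1_def)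
  have A: "\<theta>0 * (d - 1) / 2 < 1" "\<theta>0 * (d - 1) / 2 + \<theta>0 > 1" "\<theta>1 * (d - 1) / 2 < 1" "\<theta>1 * (d - 1) / 2 + \<theta>1 > 1"
  proof -
    have eq: "t * (d - 1) / 2 + t = t * (d + 1) / 2" for t by (simp add: field_simps)
    show "\<theta>0 * (d - 1) / 2 + \<theta>0 > 1" "\<theta>1 * (d - 1) / 2 + \<theta>1 > 1"
      unfolding eq using d by (simp_all add: \<theta>0_def \<theta>1_def)
  qed (use d in \<open>auto simp: \<theta>0_def \<theta>1_def\<close>)
  have pe: "p = 2 * d / (d - 2)" "p0 = 2 * (2 * d + 1) / (2 * d - 3)" "p1 = 2 * (2 * d - 1) / (2 * d - 5)"
    using d by (auto simp: p_def p_exponent_def p0_def p1_def \<theta>0_def \<theta>1_def d_def[symmetric] field_simps)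
  have p: "0 < p0" "p0 < p" "p < p1"
    unfolding pe using d by (auto simp: field_simps)
  obtain C0 where C0: "C0 > 0" and E0: "singular_energy_bound e \<theta>0 C0"
    using energy_with_singular_weight[OF \<theta>(1,2) refl, where 'n='n and e=e] A unfolding d_def by blast
  obtain C1 where C1: "C1 > 0" and E1: "singular_energy_bound e \<theta>1 C1"
    using energy_with_singular_weight[OF \<theta>(4,5) refl, where 'n='n and e=e] A unfolding d_def by blast
  define C where "C = max C0 C1"
  have C: "C > 0" "C0 \<le> C" "C1 \<le> C" using C0 by (auto simp: C_def)
  have E0': "singular_energy_bound e \<theta>0 C" and E1': "singular_energy_bound e \<theta>1 C"
    using C E0 E1 by (auto intro: singular_energy_bound_mono)
  define L where "L = p * (1 / (p - p0) + 1 / (p1 - p))"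
  have L: "L > 0" using p by (auto simp: L_def intro!: mult_pos_pos add_pos_pos)
  define K where "K = L powr (1 / p) * sqrt (exp (R\<^sup>2) * C)"
  have K: "K > 0" using L C by (simp add: K_def)
  show ?thesis
  proof (intro exI[of _ K] conjI K allI impI)
    fix g :: "real^'n \<Rightarrow> complex"
    assume g: "integrable lborel g" and supp: "\<forall>\<xi>. norm \<xi> > R \<longrightarrow> g \<xi> = 0"
    let ?N = "\<integral>\<^sup>+\<xi>. ennreal (norm (q_symbol e 1 \<xi>) * (norm (g \<xi>))\<^sup>2) \<partial>lborel"
    show "Lp_norm (p_exponent CARD('n)) (fourier g) \<le> ennreal K * epowr ?N (1 / 2)"
    proof (cases "?N = \<infinity>")
      case True
      then show ?thesis using K by (simp add: epowr_def ennreal_mult_top)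
    next
      case False
      define N where "N = enn2real ?N"
      have N: "?N = ennreal N" "N \<ge> 0" using False by (auto simp: N_def less_top)
      define a where "a = sqrt (exp (R\<^sup>2) * C * N)"
      have a: "a \<ge> 0" using C N by (simp add: a_def)
      have "(\<integral>\<^sup>+x. ennreal (norm (fourier g x) powr p) \<partial>lborel) \<le> ennreal (L * a powr p)"
        unfolding L_def
      proof (rule layer_cake_interpolation[OF _ _ p a])
        fix \<alpha> :: real assume \<alpha>: "\<alpha> > 0"
        show "emeasure lborel {x. \<alpha> \<le> norm (fourier g x)} \<le> ennreal ((a / \<alpha>) powr p0)"
          unfolding a_def p0_def
          by (rule level_set_measure[OF E0' _ \<theta>(3) g _ R N \<alpha>]) (use C supp in auto)
        show "emeasure lborel {x. \<alpha> \<le> norm (fourier g x)} \<le> ennreal ((a / \<alpha>) powr p1)"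
          unfolding a_def p1_def
          by (rule level_set_measure[OF E1' _ \<theta>(6) g _ R N \<alpha>]) (use C supp in auto)
      qed auto
      then have "Lp_norm p (fourier g) \<le> ennreal ((L * a powr p) powr (1 / p))"
        unfolding Lp_norm_def using L p by (intro epowr_mono) auto
      also have "(L * a powr p) powr (1 / p) = L powr (1 / p) * a"
        using L p a by (simp add: powr_mult powr_powr)
      also have "\<dots> = K * sqrt N"
        by (simp add: K_def a_def real_sqrt_mult)
      also have "ennreal (K * sqrt N) = ennreal K * epowr ?N (1 / 2)"
        unfolding N(1) using K N(2) by (simp add: epowr_def ennreal_mult powr_half_sqrt)
      finally show ?thesis unfolding p_def .
    qed
  qed
qed

section \<open>The extension estimate at every scale\<close>

lemma norm_q_symbol_scale: "\<tau> > 0 \<Longrightarrow> norm (q_symbol e \<tau> (\<tau> *\<^sub>R \<xi>)) = \<tau>\<^sup>2 * norm (q_symbol e 1 \<xi>)"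
proof -
  assume \<tau>: "\<tau> > 0"
  have "q_symbol e \<tau> (\<tau> *\<^sub>R \<xi>) = of_real (\<tau>\<^sup>2) * q_symbol e 1 \<xi>"
    using \<tau> by (simp add: q_symbol_def power_mult_distrib algebra_simps power2_eq_square)
  then show ?thesis by (simp add: norm_mult norm_power)
qed

lemma fourier_scale:
  fixes g :: "real^'n::finite \<Rightarrow> complex"
  assumes [measurable]: "g \<in> borel_measurable borel" and \<tau>: "\<tau> > 0"
  shows "fourier g y = of_real (\<tau> ^ CARD('n)) * fourier (\<lambda>\<xi>. g (\<tau> *\<^sub>R \<xi>)) (\<tau> *\<^sub>R y)"
proof -
  have "(LINT x|lborel. exp (- \<i> * of_real (x \<bullet> y)) * g x) = of_real (\<tau> ^ CARD('n)) *
      (LINT x|lborel. exp (- \<i> * of_real ((\<tau> *\<^sub>R x) \<bullet> y)) * g (\<tau> *\<^sub>R x))"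
    using \<tau> by (subst integral_lborel_affine[of _ \<tau> 0]) auto
  then show ?thesis by (simp add: fourier_eq mult.left_commute)
qed

text \<open>Both sides scale by \<open>\<tau>\<^bsup>d/2+1\<^esup>\<close> under the dilation \<open>g \<mapsto> g(\<tau> \<cdot>)\<close>: on the left \<open>d - d/p = d/2 + 1\<close> by the
choice of \<open>p\<close>, on the right because the symbol is homogeneous of degree 2 in \<open>(\<tau>, \<xi>)\<close>.\<close>

lemma extension_estimate:
  fixes e :: "'n::finite"
  assumes n: "CARD('n) \<ge> 3" and R: "R \<ge> 0"
  shows "\<exists>C>0. \<forall>\<tau>>0. \<forall>g :: real^'n \<Rightarrow> complex. integrable lborel g \<longrightarrow> (\<forall>\<xi>. norm \<xi> > R * \<tau> \<longrightarrow> g \<xi> = 0) \<longrightarrow>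
    Lp_norm (p_exponent CARD('n)) (fourier g)
      \<le> ennreal C * epowr (\<integral>\<^sup>+\<xi>. ennreal (norm (q_symbol e \<tau> \<xi>) * (norm (g \<xi>))\<^sup>2) \<partial>lborel) (1 / 2)"
proof -
  define d where "d = real CARD('n)"
  define p where "p = p_exponent CARD('n)"
  have d: "d \<ge> 3" using n by (simp add: d_def)
  have p: "p > 0" "d / p = d / 2 - 1" using d by (auto simp: p_def p_exponent_def d_def[symmetric] field_simps)
  obtain C where C: "C > 0" and est: "\<And>g :: real^'n \<Rightarrow> complex. integrable lborel g \<Longrightarrow> (\<forall>\<xi>. norm \<xi> > R \<longrightarrow> g \<xi> = 0) \<Longrightarrow>
    Lp_norm p (fourier g) \<le> ennreal C * epowr (\<integral>\<^sup>+\<xi>. ennreal (norm (q_symbol e 1 \<xi>) * (norm (g \<xi>))\<^sup>2) \<partial>lborel) (1 / 2)"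
    using extension_estimate_unit[OF n R, of e] unfolding p_def by blast
  show ?thesis
  proof (intro exI[of _ C] conjI C allI impI)
    fix \<tau> :: real and g :: "real^'n \<Rightarrow> complex"
    assume \<tau>: "\<tau> > 0" and g: "integrable lborel g" and supp: "\<forall>\<xi>. norm \<xi> > R * \<tau> \<longrightarrow> g \<xi> = 0"
    have [measurable]: "g \<in> borel_measurable borel" using g by simp
    define h where "h \<xi> = g (\<tau> *\<^sub>R \<xi>)" for \<xi>
    have hm[measurable]: "h \<in> borel_measurable borel" unfolding h_def by measurable
    have hi: "integrable lborel h"
    proof (rule integrableI_bounded)
      have "(\<integral>\<^sup>+\<xi>. ennreal (norm (g \<xi>)) \<partial>lborel) = ennreal (\<tau> ^ CARD('n)) * (\<integral>\<^sup>+\<xi>. ennreal (norm (h \<xi>)) \<partial>lborel)"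
        using \<tau> by (subst nn_integral_lborel_affine[of _ \<tau> 0]) (auto simp: h_def)
      moreover have "(\<integral>\<^sup>+\<xi>. ennreal (norm (g \<xi>)) \<partial>lborel) < \<infinity>"
        using g by (simp add: integrable_iff_bounded)
      ultimately show "(\<integral>\<^sup>+\<xi>. ennreal (norm (h \<xi>)) \<partial>lborel) < \<infinity>"
        using \<tau> by (auto simp: ennreal_mult_less_top)
    qed simp
    have hs: "\<forall>\<xi>. norm \<xi> > R \<longrightarrow> h \<xi> = 0"
    proof (intro allI impI)
      fix \<xi> :: "real^'n" assume "norm \<xi> > R"
      then have "norm (\<tau> *\<^sub>R \<xi>) > R * \<tau>" using \<tau> by (simp add: mult.commute)
      then show "h \<xi> = 0" unfolding h_def using supp by blast
    qed
    let ?N = "\<integral>\<^sup>+\<xi>. ennreal (norm (q_symbol e \<tau> \<xi>) * (norm (g \<xi>))\<^sup>2) \<partial>lborel"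
    let ?M = "\<integral>\<^sup>+\<xi>. ennreal (norm (q_symbol e 1 \<xi>) * (norm (h \<xi>))\<^sup>2) \<partial>lborel"
    let ?P = "\<integral>\<^sup>+x. ennreal (norm (fourier h x) powr p) \<partial>lborel"
    have NM: "?N = ennreal (\<tau> powr (d + 2)) * ?M"
    proof -
      have "?N = ennreal (\<tau> ^ CARD('n)) * (\<integral>\<^sup>+\<xi>. ennreal (\<tau>\<^sup>2) * ennreal (norm (q_symbol e 1 \<xi>) * (norm (h \<xi>))\<^sup>2) \<partial>lborel)"
        using \<tau> by (subst nn_integral_lborel_affine[of _ \<tau> 0])
          (auto simp: h_def norm_q_symbol_scale mult.assoc simp flip: ennreal_mult)
      also have "\<dots> = ennreal (\<tau> ^ CARD('n)) * (ennreal (\<tau>\<^sup>2) * ?M)"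
        by (subst nn_integral_cmult) auto
      also have "\<dots> = ennreal (\<tau> ^ CARD('n) * \<tau>\<^sup>2) * ?M"
        using \<tau> by (simp add: ennreal_mult mult.assoc)
      also have "\<tau> ^ CARD('n) * \<tau>\<^sup>2 = \<tau> powr (d + 2)"
        using \<tau> by (simp add: powr_add d_def powr_realpow)
      finally show ?thesis .
    qed
    have P: "(\<integral>\<^sup>+x. ennreal (norm (fourier g x) powr p) \<partial>lborel) = ennreal (\<tau> powr (d * p - d)) * ?P"
    proof -
      have "(\<integral>\<^sup>+x. ennreal (norm (fourier g x) powr p) \<partial>lborel)
          = (\<integral>\<^sup>+x. ennreal (\<tau> powr (d * p)) * ennreal (norm (fourier h (\<tau> *\<^sub>R x)) powr p) \<partial>lborel)"
        using \<tau> by (intro nn_integral_cong, subst fourier_scale[OF _ \<tau>])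
          (auto simp: h_def[symmetric] norm_mult norm_power powr_mult powr_powr d_def simp flip: ennreal_mult powr_realpow)
      also have "\<dots> = ennreal (\<tau> powr (d * p)) * (\<integral>\<^sup>+x. ennreal (norm (fourier h (\<tau> *\<^sub>R x)) powr p) \<partial>lborel)"
        by (rule nn_integral_cmult) measurable
      also have "(\<integral>\<^sup>+x. ennreal (norm (fourier h (\<tau> *\<^sub>R x)) powr p) \<partial>lborel) = ennreal ((1 / \<tau>) ^ CARD('n)) * ?P"
        using \<tau> by (subst nn_integral_lborel_affine[of _ "1 / \<tau>" 0]) auto
      also have "ennreal (\<tau> powr (d * p)) * (ennreal ((1 / \<tau>) ^ CARD('n)) * ?P) = ennreal (\<tau> powr (d * p) * (1 / \<tau>) ^ CARD('n)) * ?P"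
        using \<tau> by (subst ennreal_mult) (auto simp: mult.assoc)
      also have "\<tau> powr (d * p) * (1 / \<tau>) ^ CARD('n) = \<tau> powr (d * p - d)"
        using \<tau> by (simp add: powr_diff d_def powr_realpow power_divide)
      finally show ?thesis .
    qed
    have "Lp_norm p (fourier g) = ennreal ((\<tau> powr (d * p - d)) powr (1 / p)) * Lp_norm p (fourier h)"
      unfolding Lp_norm_def P using \<tau> by (intro epowr_cmult) simp
    also have "(\<tau> powr (d * p - d)) powr (1 / p) = \<tau> powr ((d + 2) / 2)"
      unfolding powr_powr using p d by (intro arg_cong[where f = "\<lambda>a. \<tau> powr a"]) (simp add: diff_divide_distrib)
    also have "ennreal (\<tau> powr ((d + 2) / 2)) * Lp_norm p (fourier h) \<le> ennreal (\<tau> powr ((d + 2) / 2)) * (ennreal C * epowr ?M (1 / 2))"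
      by (intro mult_left_mono est hi hs) simp
    also have "\<dots> = ennreal C * (ennreal ((\<tau> powr (d + 2)) powr (1 / 2)) * epowr ?M (1 / 2))"
      by (simp add: powr_powr mult.left_commute)
    also have "ennreal ((\<tau> powr (d + 2)) powr (1 / 2)) * epowr ?M (1 / 2) = epowr ?N (1 / 2)"
      unfolding NM using \<tau> by (subst epowr_cmult) auto
    finally show "Lp_norm (p_exponent CARD('n)) (fourier g) \<le> ennreal C * epowr ?N (1 / 2)"
      unfolding p_def .
  qed
qed

section \<open>Frequency pieces and their norms\<close>

lemma Lp_norm_inv_fourier: "Lp_norm p (inv_fourier g) = Lp_norm p (fourier (g :: real^'n::finite \<Rightarrow> complex))"
proof -
  have "(\<integral>\<^sup>+x. ennreal (norm (fourier g x) powr p) \<partial>lborel) = (\<integral>\<^sup>+x. ennreal (norm (fourier g (- x)) powr p) \<partial>lborel)"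
    by (subst nn_integral_lborel_affine[of _ "-1" 0]) auto
  then show ?thesis unfolding Lp_norm_def inv_fourier_eq by simp
qed

lemma integrable_compact_support:
  fixes g :: "real^'n::finite \<Rightarrow> complex"
  assumes c: "continuous_on UNIV g" and z: "\<And>\<xi>. norm \<xi> > R \<Longrightarrow> g \<xi> = 0"
  shows "integrable lborel g"
proof -
  have "integrable lborel (\<lambda>\<xi>. indicator (cball 0 R) \<xi> *\<^sub>R g \<xi>)"
    by (rule borel_integrable_compact[OF compact_cball continuous_on_subset[OF c]]) simp
  also have "(\<lambda>\<xi>. indicator (cball 0 R) \<xi> *\<^sub>R g \<xi>) = g"
    using z by (auto simp: fun_eq_iff indicator_def not_le)
  finally show ?thesis .
qed

lemma bounded_compact_support:
  fixes g :: "real^'n::finite \<Rightarrow> complex"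
  assumes c: "continuous_on UNIV g" and z: "\<And>\<xi>. norm \<xi> > R \<Longrightarrow> g \<xi> = 0"
  obtains B where "\<And>\<xi>. norm (g \<xi>) \<le> B"
proof -
  have "bounded (g ` cball 0 R)"
    by (intro compact_imp_bounded compact_continuous_image continuous_on_subset[OF c] compact_cball) simp
  then obtain B where B: "\<And>\<xi>. \<xi> \<in> cball 0 R \<Longrightarrow> norm (g \<xi>) \<le> B"
    by (metis bounded_iff imageI)
  have "norm (g \<xi>) \<le> max B 0" for \<xi>
    using B[of \<xi>] z[of \<xi>] by (cases "norm \<xi> \<le> R") (auto simp: not_le)
  then show ?thesis by (rule that)
qed

text \<open>If the inverse transform of \<open>g\<close> is integrable, this is Fourier inversion; otherwise its Fourier
transform is 0 by convention, and the inequality holds trivially.\<close>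

lemma norm_fourier_inv_fourier_le:
  fixes g :: "real^'n::finite \<Rightarrow> complex"
  assumes c: "continuous_on UNIV g" and z: "\<And>\<xi>. norm \<xi> > R \<Longrightarrow> g \<xi> = 0"
  shows "norm (fourier (inv_fourier g) \<xi>) \<le> norm (g \<xi>)"
proof (cases "integrable lborel (inv_fourier g)")
  case True
  obtain B where B: "\<And>\<xi>. norm (g \<xi>) \<le> B" using bounded_compact_support[of g R] c z by blast
  show ?thesis using fourier_inversion[OF c integrable_compact_support[OF c z] B True] by simp
qed (simp add: fourier_not_integrable)

lemma m_symbol_le_q_symbol: "m_symbol (\<tau>\<^sup>2) \<xi> \<le> norm (q_symbol e \<tau> \<xi>)"
  using abs_Re_le_cmod[of "q_symbol e \<tau> \<xi>"] by (simp add: m_symbol_def q_symbol_def)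

lemma Lp_norm_2_square: "(Lp_norm 2 f)\<^sup>2 = (\<integral>\<^sup>+x. ennreal ((norm (f x))\<^sup>2) \<partial>lborel)"
  unfolding Lp_norm_def epowr_half_square by simp

lemma m_weighted_norm_le:
  fixes g :: "real^'n::finite \<Rightarrow> complex"
  assumes c: "continuous_on UNIV g" and z: "\<And>\<xi>. norm \<xi> > R \<Longrightarrow> g \<xi> = 0"
  shows "(Lp_norm 2 (\<lambda>\<xi>. of_real (sqrt (m_symbol (\<tau>\<^sup>2) \<xi>)) * fourier (inv_fourier g) \<xi>))\<^sup>2
    \<le> (\<integral>\<^sup>+\<xi>. ennreal (norm (q_symbol e \<tau> \<xi>) * (norm (g \<xi>))\<^sup>2) \<partial>lborel)"
  unfolding Lp_norm_2_square
proof (intro nn_integral_mono ennreal_leI)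
  fix \<xi>
  have "(norm (of_real (sqrt (m_symbol (\<tau>\<^sup>2) \<xi>)) * fourier (inv_fourier g) \<xi>))\<^sup>2 = m_symbol (\<tau>\<^sup>2) \<xi> * (norm (fourier (inv_fourier g) \<xi>))\<^sup>2"
    by (simp add: norm_mult power_mult_distrib m_symbol_def)
  also have "\<dots> \<le> norm (q_symbol e \<tau> \<xi>) * (norm (g \<xi>))\<^sup>2"
    using norm_fourier_inv_fourier_le[OF c z]
    by (intro mult_mono m_symbol_le_q_symbol power_mono) auto
  finally show "(norm (of_real (sqrt (m_symbol (\<tau>\<^sup>2) \<xi>)) * fourier (inv_fourier g) \<xi>))\<^sup>2 \<le> norm (q_symbol e \<tau> \<xi>) * (norm (g \<xi>))\<^sup>2" .
qed

lemma LP_cutoff_continuous: "LP_cutoff \<phi> \<Longrightarrow> continuous_on UNIV \<phi>"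
proof -
  assume "LP_cutoff \<phi>"
  then have "\<forall>is x. iter_partial is \<phi> differentiable (at x)" by (auto simp: LP_cutoff_def schwartz_def)
  then have "\<phi> differentiable (at x)" for x by (metis iter_partial.simps(1))
  then show ?thesis by (meson continuous_at_imp_continuous_on differentiable_imp_continuous_within)
qed

lemma LP_psi_support:
  assumes "LP_cutoff \<phi>" "LP_psi \<phi> \<xi> \<noteq> 0"
  shows "1 / 2 < norm \<xi>" "norm \<xi> \<le> 2"
proof -
  have z: "\<And>\<eta>. norm \<eta> > 2 \<Longrightarrow> \<phi> \<eta> = 0" and o: "\<And>\<eta>. norm \<eta> \<le> 1 \<Longrightarrow> \<phi> \<eta> = 1"
    using assms(1) by (auto simp: LP_cutoff_def)
  show "1 / 2 < norm \<xi>"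
  proof (rule ccontr)
    assume "\<not> 1 / 2 < norm \<xi>"
    then have "\<phi> \<xi> = 1" "\<phi> (2 *\<^sub>R \<xi>) = 1" by (auto intro!: o)
    then show False using assms(2) by (simp add: LP_psi_def)
  qed
  show "norm \<xi> \<le> 2"
  proof (rule ccontr)
    assume "\<not> norm \<xi> \<le> 2"
    then have "\<phi> \<xi> = 0" "\<phi> (2 *\<^sub>R \<xi>) = 0" by (auto intro!: z)
    then show False using assms(2) by (simp add: LP_psi_def)
  qed
qed

lemma LP_psi_bound:
  assumes "\<And>\<xi>. norm (\<phi> \<xi>) \<le> B"
  shows "norm (LP_psi \<phi> \<eta>) \<le> 2 * B"
  unfolding LP_psi_def
  using norm_triangle_ineq4[of "\<phi> \<eta>" "\<phi> (2 *\<^sub>R \<eta>)"] assms[of \<eta>] assms[of "2 *\<^sub>R \<eta>"] by linarith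

lemma powi_2_le_iff: "(2::real) powi k \<le> 2 powi l \<longleftrightarrow> k \<le> l"
  using power_int_increasing[of k l "2::real"] power_int_strict_increasing[of l k "2::real"] by (auto simp: not_le[symmetric])

text \<open>The cutoff at scale \<open>2\<^sup>k\<close> lives on \<open>2\<^bsup>k-1\<^esup> < |\<xi>| \<le> 2\<^bsup>k+1\<^esup>\<close>, so at most two of them are nonzero at a
given point, each of size at most \<open>2B\<close>.\<close>

lemma LP_psi_square_sum_le:
  assumes \<phi>: "LP_cutoff \<phi>" and B: "\<And>\<xi>. norm (\<phi> \<xi>) \<le> B" and F: "finite F"
  shows "(\<Sum>k\<in>F. (norm (LP_psi \<phi> (\<xi> /\<^sub>R (2 powi k))))\<^sup>2) \<le> 8 * B\<^sup>2"
proof -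
  have psi: "norm (LP_psi \<phi> \<eta>) \<le> 2 * B" for \<eta> by (rule LP_psi_bound[OF B])
  define S where "S = {k\<in>F. LP_psi \<phi> (\<xi> /\<^sub>R (2 powi k)) \<noteq> 0}"
  have S: "2 powi (k - 1) < norm \<xi>" "norm \<xi> \<le> 2 powi (k + 1)" if "k \<in> S" for k
    using LP_psi_support[OF \<phi>, of "\<xi> /\<^sub>R (2 powi k)"] that
    by (auto simp: S_def power_int_diff power_int_add field_simps)
  have "card S \<le> 2"
  proof (cases "S = {}")
    case False
    moreover have fS: "finite S" using F by (simp add: S_def)
    ultimately obtain m where m: "m \<in> S" "\<And>k. k \<in> S \<Longrightarrow> m \<le> k"
      using Min_in[of S] Min_le[of S] by blast
    have "S \<subseteq> {m, m + 1}"
    proof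
      fix k assume k: "k \<in> S"
      have "(2::real) powi (k - 1) < 2 powi (m + 1)" using S(1)[OF k] S(2)[OF m(1)] by linarith
      then have "\<not> m + 1 \<le> k - 1" using powi_2_le_iff[of "m + 1" "k - 1"] by linarith
      then show "k \<in> {m, m + 1}" using m(2)[OF k] by auto
    qed
    then have "card S \<le> card {m, m + 1}" by (intro card_mono) auto
    then show ?thesis by simp
  qed simp
  have "(\<Sum>k\<in>F. (norm (LP_psi \<phi> (\<xi> /\<^sub>R (2 powi k))))\<^sup>2) = (\<Sum>k\<in>S. (norm (LP_psi \<phi> (\<xi> /\<^sub>R (2 powi k))))\<^sup>2)"
    using F by (intro sum.mono_neutral_right) (auto simp: S_def)
  also have "\<dots> \<le> of_nat (card S) * (2 * B)\<^sup>2"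
    by (intro sum_bounded_above power_mono psi) auto
  also have "\<dots> \<le> 2 * (2 * B)\<^sup>2" using \<open>card S \<le> 2\<close> by (intro mult_right_mono) auto
  finally show ?thesis by (simp add: power_mult_distrib)
qed

section \<open>The embedding\<close>

theorem lemma4p22:
  fixes \<phi> :: "real^'n::finite \<Rightarrow> complex" and e :: 'n
  assumes "CARD('n) \<ge> 3"
    and "LP_cutoff \<phi>"
  shows "\<exists>C::real. C > 0 \<and>
    (\<forall>\<tau> lam. \<tau> > 0 \<longrightarrow> lam = \<tau>\<^sup>2 \<longrightarrow>
      (\<forall>f :: real^'n \<Rightarrow> complex. schwartz f \<longrightarrow>
        Zstar_norm \<phi> lam (p_exponent CARD('n)) f \<le> ennreal C * Y_norm e (1 / 2) \<tau> f))"
proof -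
  let ?p = "p_exponent CARD('n)"
  note \<phi> = assms(2)
  have \<phi>c: "continuous_on UNIV \<phi>" by (rule LP_cutoff_continuous[OF \<phi>])
  have \<phi>z: "\<phi> \<xi> = 0" if "norm \<xi> > 2" for \<xi> using \<phi> that by (simp add: LP_cutoff_def)
  obtain B where B: "\<And>\<xi>. norm (\<phi> \<xi>) \<le> B" using bounded_compact_support[OF \<phi>c \<phi>z] by blast
  obtain K where K: "K > 0" and est: "\<And>\<tau> (g :: real^'n \<Rightarrow> complex). \<tau> > 0 \<Longrightarrow> integrable lborel g \<Longrightarrow>
      (\<And>\<xi>. norm \<xi> > 8 * \<tau> \<Longrightarrow> g \<xi> = 0) \<Longrightarrow>
      Lp_norm ?p (fourier g) \<le> ennreal K * epowr (\<integral>\<^sup>+\<xi>. ennreal (norm (q_symbol e \<tau> \<xi>) * (norm (g \<xi>))\<^sup>2) \<partial>lborel) (1 / 2)"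
    using extension_estimate[OF assms(1), of 8 e] by auto
  define c where "c = B\<^sup>2 + 4 * (K\<^sup>2 * (4 * B\<^sup>2)) + 8 * B\<^sup>2 + 1"
  have c: "c > 0" by (simp add: c_def add_nonneg_pos)
  show ?thesis
  proof (intro exI[of _ "sqrt c"] conjI allI impI)
    show "sqrt c > 0" using c by simp
    fix \<tau> lam :: real and f :: "real^'n \<Rightarrow> complex"
    assume \<tau>: "\<tau> > 0" and lam: "lam = \<tau>\<^sup>2" and "schwartz f"
    let ?Q = "\<lambda>\<xi>. norm (q_symbol e \<tau> \<xi>)" and ?F = "fourier f"
    define N where "N = (\<integral>\<^sup>+\<xi>. ennreal (?Q \<xi> * (norm (?F \<xi>))\<^sup>2) \<partial>lborel)"
    define k\<^sub>0 where "k\<^sub>0 = k_index lam"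
    have k0: "2 powi (k\<^sub>0 - 1) < \<tau>" using k_index_bounds(1)[of lam] \<tau> by (simp add: lam k\<^sub>0_def)
    have Y: "Y_norm e (1 / 2) \<tau> f = epowr N (1 / 2)"
      unfolding Y_norm_def Lp_norm_def N_def
      by (simp add: norm_mult power_mult_distrib powr_half_sqrt)
    define mlt where "mlt \<mu> k = (\<lambda>\<xi>. \<mu> (\<xi> /\<^sub>R (2 powi k)) * ?F \<xi>)" for \<mu> :: "real^'n \<Rightarrow> complex" and k :: int
    have mc: "continuous_on UNIV (mlt \<mu> k)" if "continuous_on UNIV \<mu>" for \<mu> k
      unfolding mlt_def
      by (intro continuous_intros continuous_on_fourier continuous_on_compose2[OF that]) auto
    have mz: "mlt \<mu> k \<xi> = 0" if "\<And>\<eta>. norm \<eta> > 2 \<Longrightarrow> \<mu> \<eta> = 0" "norm \<xi> > 2 * 2 powi k" for \<mu> k \<xi>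
    proof -
      have "norm (\<xi> /\<^sub>R (2 powi k)) > 2" using that(2) by (simp add: field_simps)
      then show ?thesis using that(1) by (simp add: mlt_def)
    qed
    have me: "(\<integral>\<^sup>+\<xi>. ennreal (?Q \<xi> * (norm (mlt \<mu> k \<xi>))\<^sup>2) \<partial>lborel) \<le> ennreal (b\<^sup>2) * N"
      if "\<And>\<eta>. norm (\<mu> \<eta>) \<le> b" for \<mu> k b
    proof -
      have "(\<integral>\<^sup>+\<xi>. ennreal (?Q \<xi> * (norm (mlt \<mu> k \<xi>))\<^sup>2) \<partial>lborel) \<le> (\<integral>\<^sup>+\<xi>. ennreal (b\<^sup>2) * ennreal (?Q \<xi> * (norm (?F \<xi>))\<^sup>2) \<partial>lborel)"
      proof (rule nn_integral_mono)
        fix \<xi>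
        have "(norm (\<mu> (\<xi> /\<^sub>R (2 powi k))))\<^sup>2 * (?Q \<xi> * (norm (?F \<xi>))\<^sup>2) \<le> b\<^sup>2 * (?Q \<xi> * (norm (?F \<xi>))\<^sup>2)"
          by (intro mult_right_mono power_mono that) auto
        then have "?Q \<xi> * (norm (mlt \<mu> k \<xi>))\<^sup>2 \<le> b\<^sup>2 * (?Q \<xi> * (norm (?F \<xi>))\<^sup>2)"
          by (simp add: mlt_def norm_mult power_mult_distrib mult_ac)
        then show "ennreal (?Q \<xi> * (norm (mlt \<mu> k \<xi>))\<^sup>2) \<le> ennreal (b\<^sup>2) * ennreal (?Q \<xi> * (norm (?F \<xi>))\<^sup>2)"
          by (simp add: ennreal_leI flip: ennreal_mult)
      qed
      also have "\<dots> = ennreal (b\<^sup>2) * N" unfolding N_def by (rule nn_integral_cmult) measurable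
      finally show ?thesis .
    qed
    have \<psi>c: "continuous_on UNIV (LP_psi \<phi>)"
      unfolding LP_psi_def[abs_def] by (intro continuous_intros continuous_on_compose2[OF \<phi>c]) auto
    have \<psi>z: "LP_psi \<phi> \<eta> = 0" if "norm \<eta> > 2" for \<eta> using LP_psi_support(2)[OF \<phi>, of \<eta>] that by force
    have \<psi>b: "norm (LP_psi \<phi> \<eta>) \<le> 2 * B" for \<eta> by (rule LP_psi_bound[OF B])
    have low: "(Lp_norm 2 (\<lambda>\<xi>. of_real (sqrt (m_symbol lam \<xi>)) * fourier (LP_proj_le \<phi> (k\<^sub>0 - 3) f) \<xi>))\<^sup>2 \<le> ennreal (B\<^sup>2) * N"
      unfolding LP_proj_le_def lam mlt_def[symmetric]
      by (rule order_trans[OF m_weighted_norm_le[OF mc[OF \<phi>c] mz[OF \<phi>z]] me[OF B]])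
    have mid: "(Lp_norm ?p (LP_proj \<phi> k f))\<^sup>2 \<le> ennreal (K\<^sup>2 * (4 * B\<^sup>2)) * N" if k: "k \<le> k\<^sub>0 + 1" for k
    proof -
      \<comment> \<open>The cutoff is supported in \<open>|\<xi>| \<le> 2 \<cdot> 2\<^sup>k\<close>, and \<open>2\<^sup>k \<le> 4 \<cdot> 2\<^bsup>k\<^sub>0-1\<^esup> < 4\<tau>\<close>.\<close>
      have "(2::real) powi k \<le> 2 powi (k\<^sub>0 - 1 + 2)" using k by (intro power_int_increasing) auto
      also have "\<dots> = 4 * 2 powi (k\<^sub>0 - 1)" by (subst power_int_add) auto
      finally have "2 * 2 powi k \<le> 8 * \<tau>" using k0 by simp
      then have z: "mlt (LP_psi \<phi>) k \<xi> = 0" if "norm \<xi> > 8 * \<tau>" for \<xi> using that by (intro mz[OF \<psi>z]) auto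
      have "Lp_norm ?p (LP_proj \<phi> k f) = Lp_norm ?p (fourier (mlt (LP_psi \<phi>) k))"
        unfolding LP_proj_def mlt_def[symmetric] by (rule Lp_norm_inv_fourier)
      also have "\<dots> \<le> ennreal K * epowr (\<integral>\<^sup>+\<xi>. ennreal (?Q \<xi> * (norm (mlt (LP_psi \<phi>) k \<xi>))\<^sup>2) \<partial>lborel) (1 / 2)"
        by (rule est[OF \<tau> integrable_compact_support[OF mc[OF \<psi>c] z] z])
      finally have "(Lp_norm ?p (LP_proj \<phi> k f))\<^sup>2 \<le> (ennreal K * epowr (\<integral>\<^sup>+\<xi>. ennreal (?Q \<xi> * (norm (mlt (LP_psi \<phi>) k \<xi>))\<^sup>2) \<partial>lborel) (1 / 2))\<^sup>2"
        by (rule power_mono) simp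
      also have "\<dots> = ennreal (K\<^sup>2) * (\<integral>\<^sup>+\<xi>. ennreal (?Q \<xi> * (norm (mlt (LP_psi \<phi>) k \<xi>))\<^sup>2) \<partial>lborel)"
        unfolding power_mult_distrib epowr_half_square using K by (simp add: ennreal_power)
      also have "\<dots> \<le> ennreal (K\<^sup>2) * (ennreal ((2 * B)\<^sup>2) * N)" by (intro mult_left_mono me \<psi>b) simp
      also have "\<dots> = ennreal (K\<^sup>2 * (4 * B\<^sup>2)) * N"
        by (subst ennreal_mult) (auto simp: mult.assoc power_mult_distrib)
      finally show ?thesis .
    qed
    let ?H = "\<lambda>k. (Lp_norm 2 (\<lambda>\<xi>. of_real (sqrt (m_symbol lam \<xi>)) * fourier (LP_proj \<phi> k f) \<xi>))\<^sup>2"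
    have high: "(\<Sum>\<^sub>\<infinity>k\<in>{k. k > k\<^sub>0 + 1}. ?H k) \<le> ennreal (8 * B\<^sup>2) * N"
    proof (rule infsum_le_finite_sums)
      show "?H summable_on {k. k > k\<^sub>0 + 1}" by (rule nonneg_summable_on_complete) simp
      fix F :: "int set" assume F: "finite F"
      have "(\<Sum>k\<in>F. ?H k) \<le> (\<Sum>k\<in>F. \<integral>\<^sup>+\<xi>. ennreal (?Q \<xi> * (norm (mlt (LP_psi \<phi>) k \<xi>))\<^sup>2) \<partial>lborel)"
        unfolding LP_proj_def lam mlt_def[symmetric]
        by (intro sum_mono m_weighted_norm_le[OF mc[OF \<psi>c] mz[OF \<psi>z]])
      also have "\<dots> = (\<integral>\<^sup>+\<xi>. (\<Sum>k\<in>F. ennreal (?Q \<xi> * (norm (mlt (LP_psi \<phi>) k \<xi>))\<^sup>2)) \<partial>lborel)"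
      proof (rule nn_integral_sum[symmetric])
        fix k
        have [measurable]: "mlt (LP_psi \<phi>) k \<in> borel_measurable borel"
          by (rule borel_measurable_continuous_onI[OF mc[OF \<psi>c]])
        show "(\<lambda>\<xi>. ennreal (?Q \<xi> * (norm (mlt (LP_psi \<phi>) k \<xi>))\<^sup>2)) \<in> borel_measurable lborel" by measurable
      qed
      also have "\<dots> \<le> (\<integral>\<^sup>+\<xi>. ennreal (8 * B\<^sup>2) * ennreal (?Q \<xi> * (norm (?F \<xi>))\<^sup>2) \<partial>lborel)"
      proof (rule nn_integral_mono)
        fix \<xi>
        have "(\<Sum>k\<in>F. ennreal (?Q \<xi> * (norm (mlt (LP_psi \<phi>) k \<xi>))\<^sup>2)) = ennreal (\<Sum>k\<in>F. ?Q \<xi> * (norm (mlt (LP_psi \<phi>) k \<xi>))\<^sup>2)"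
          by (intro sum_ennreal) auto
        also have "(\<Sum>k\<in>F. ?Q \<xi> * (norm (mlt (LP_psi \<phi>) k \<xi>))\<^sup>2) = (\<Sum>k\<in>F. (norm (LP_psi \<phi> (\<xi> /\<^sub>R (2 powi k))))\<^sup>2) * (?Q \<xi> * (norm (?F \<xi>))\<^sup>2)"
          unfolding sum_distrib_right by (intro sum.cong refl) (simp add: mlt_def norm_mult power_mult_distrib mult_ac)
        also have "\<dots> \<le> (8 * B\<^sup>2) * (?Q \<xi> * (norm (?F \<xi>))\<^sup>2)"
          by (intro mult_right_mono LP_psi_square_sum_le[OF \<phi> B F]) auto
        finally show "(\<Sum>k\<in>F. ennreal (?Q \<xi> * (norm (mlt (LP_psi \<phi>) k \<xi>))\<^sup>2)) \<le> ennreal (8 * B\<^sup>2) * ennreal (?Q \<xi> * (norm (?F \<xi>))\<^sup>2)"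
          by (simp add: ennreal_leI flip: ennreal_mult)
      qed
      also have "\<dots> = ennreal (8 * B\<^sup>2) * N" unfolding N_def by (rule nn_integral_cmult) measurable
      finally show "(\<Sum>k\<in>F. ?H k) \<le> ennreal (8 * B\<^sup>2) * N" .
    qed
    have "(\<Sum>k\<in>{k\<^sub>0 - 2 .. k\<^sub>0 + 1}. (Lp_norm ?p (LP_proj \<phi> k f))\<^sup>2) \<le> of_nat (card {k\<^sub>0 - 2 .. k\<^sub>0 + 1}) * (ennreal (K\<^sup>2 * (4 * B\<^sup>2)) * N)"
      by (rule sum_bounded_above) (use mid in auto)
    also have "\<dots> = ennreal (4 * (K\<^sup>2 * (4 * B\<^sup>2))) * N"
      by (subst (2) ennreal_mult) (auto simp: mult.assoc)
    finally have "Zstar_norm \<phi> lam ?p f \<le> epowr (ennreal (B\<^sup>2) * N + ennreal (4 * (K\<^sup>2 * (4 * B\<^sup>2))) * N + ennreal (8 * B\<^sup>2) * N) (1 / 2)"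
      unfolding Zstar_norm_def k\<^sub>0_def[symmetric] by (intro epowr_le add_mono low high) auto
    also have "\<dots> \<le> epowr (ennreal c * N) (1 / 2)"
    proof (rule epowr_le)
      have "ennreal (B\<^sup>2) * N + ennreal (4 * (K\<^sup>2 * (4 * B\<^sup>2))) * N + ennreal (8 * B\<^sup>2) * N = ennreal (B\<^sup>2 + 4 * (K\<^sup>2 * (4 * B\<^sup>2)) + 8 * B\<^sup>2) * N"
        by (simp only: distrib_right[symmetric] ennreal_plus[symmetric] zero_le_power2
            mult_nonneg_nonneg add_nonneg_nonneg zero_le_numeral)
      also have "\<dots> \<le> ennreal c * N" by (intro mult_right_mono ennreal_leI) (auto simp: c_def)
      finally show "ennreal (B\<^sup>2) * N + ennreal (4 * (K\<^sup>2 * (4 * B\<^sup>2))) * N + ennreal (8 * B\<^sup>2) * N \<le> ennreal c * N" .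
    qed simp
    also have "\<dots> = ennreal (sqrt c) * Y_norm e (1 / 2) \<tau> f"
      unfolding Y epowr_cmult[OF c] using c by (simp add: powr_half_sqrt)
    finally show "Zstar_norm \<phi> lam ?p f \<le> ennreal (sqrt c) * Y_norm e (1 / 2) \<tau> f" .
  qed
qed

end
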